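(* Let $\mathcal F:\mathbb{R}^n\rightrightarrows\mathbb{R}^n$ be an upper semi-continuous set-valued map taking non-empty, convex and compact values, with $0\in\mathcal F(\bar x)$ for some $\bar x\in\mathbb{R}^n$. Assume there exists a positive definite, radially unbounded, locally Lipschitz continuous and regular function $V:\mathbb{R}^n\to\mathbb{R}$ with $V(\bar x)=0$ and constants $a,b>0$, $\xi>1$ such that $$\sup\dot V(x)\le-\left(aV(x)^{1-\frac1\xi}+bV(x)^{1+\frac1\xi}\right)\quad\text{for every }x\in\mathbb{R}^n\setminus\{\bar x\},$$ and assume moreover that there is $\beta>0$ with $V(x)\ge\beta\|x-\bar x\|^2$ for every $x\in\mathbb{R}^n$. Then for all $x_0\in\mathbb{R}^n$ and $\epsilon>0$ there exists $\eta^*>0$ such that for any $\eta\in(0,\eta^*]$ and any solution $(x_k)_{k\ge0}$ of the forward-Euler discretization $$x_{k+1}\in x_k+\eta\,\mathcal F(x_k)$$ starting from the point $x_0$, the following holds for all integers $k\ge 0$: $$\|x_k-\bar x\|<\begin{cases}\dfrac{1}{\sqrt\beta}\left(\sqrt{\dfrac ab}\tan\left(\dfrac\pi2-\dfrac{\sqrt{ab}}{\xi}\eta k\right)\right)^{\frac{\xi}{2}}+\epsilon,& k<\dfrac{\xi\pi}{2\eta\sqrt{ab}},\\[2mm] \epsilon,&\text{otherwise,}\end{cases}$$ where for $k=0$ the right-hand side is read as $+\infty$.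
   Context: $\mathbb{R}^n$ carries an inner product $\langle\cdot,\cdot\rangle$ with induced norm $\|\cdot\|$. Positive definite here means $V(x)>0$ for all $x\ne\bar x$ (together with $V(\bar x)=0$); radially unbounded means $V(x)\to\infty$ as $\|x\|\to\infty$. A locally Lipschitz $V$ is regular if at every $x$ and in every direction $v$ the usual one-sided directional derivative $\lim_{h\downarrow0}\frac{V(x+hv)-V(x)}{h}$ exists and equals Clarke's generalized directional derivative $\limsup_{z\to x,\,h\downarrow0}\frac{V(z+hv)-V(z)}{h}$. $\partial_cV(x)$ denotes Clarke's generalized gradient of $V$ at $x$. The set-valued derivative of $V$ with respect to $\mathcal F$ is $$\dot V(x)=\{\ell\in\mathbb{R}:\exists v\in\mathcal F(x)\text{ such that }\langle p,v\rangle=\ell\ \ \forall p\in\partial_cV(x)\},$$ with the convention $\sup\emptyset=-\infty$. *)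

theory Defs
  imports "HOL-Analysis.Analysis"
begin

definition upper_semicontinuous_map ::
    "('a::topological_space \<Rightarrow> 'b::topological_space set) \<Rightarrow> bool" where
  "upper_semicontinuous_map F \<longleftrightarrow>
     (\<forall>x U. open U \<and> F x \<subseteq> U \<longrightarrow> (\<forall>\<^sub>F y in nhds x. F y \<subseteq> U))"

(* The library's local_lipschitz is about families of maps depending on a time parameter. *)
definition locally_lipschitz :: "('a::metric_space \<Rightarrow> 'b::metric_space) \<Rightarrow> bool" where
  "locally_lipschitz f \<longleftrightarrow> (\<forall>x. \<exists>u>0. \<exists>L. L-lipschitz_on (ball x u) f)"

(* The base point z ranges over full neighbourhoods of x, so z = x is allowed. The value is
   extended real so that the limsup always exists; it is finite for locally Lipschitz V. *)
definition clarke_dir_deriv :: "('a::real_normed_vector \<Rightarrow> real) \<Rightarrow> 'a \<Rightarrow> 'a \<Rightarrow> ereal" where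
  "clarke_dir_deriv V x v =
     Limsup (nhds x \<times>\<^sub>F at_right 0) (\<lambda>(z, h). ereal ((V (z + h *\<^sub>R v) - V z) / h))"

definition clarke_gradient :: "('a::real_inner \<Rightarrow> real) \<Rightarrow> 'a \<Rightarrow> 'a set" where
  "clarke_gradient V x = {p. \<forall>v. ereal (p \<bullet> v) \<le> clarke_dir_deriv V x v}"

definition clarke_regular :: "('a::real_normed_vector \<Rightarrow> real) \<Rightarrow> bool" where
  "clarke_regular V \<longleftrightarrow>
     (\<forall>x v. \<exists>d. ((\<lambda>h. (V (x + h *\<^sub>R v) - V x) / h) \<longlongrightarrow> d) (at_right 0)
              \<and> ereal d = clarke_dir_deriv V x v)"

definition set_valued_derivative ::
    "('a::real_inner \<Rightarrow> 'a set) \<Rightarrow> ('a \<Rightarrow> real) \<Rightarrow> 'a \<Rightarrow> real set" where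
  "set_valued_derivative F V x = {l. \<exists>v \<in> F x. \<forall>p \<in> clarke_gradient V x. p \<bullet> v = l}"

definition forward_euler_solution ::
    "('a::real_vector \<Rightarrow> 'a set) \<Rightarrow> real \<Rightarrow> 'a \<Rightarrow> (nat \<Rightarrow> 'a) \<Rightarrow> bool" where
  "forward_euler_solution F \<eta> x0 x \<longleftrightarrow>
     x 0 = x0 \<and> (\<forall>k. \<exists>v \<in> F (x k). x (Suc k) = x k + \<eta> *\<^sub>R v)"

(* At k = 0 the tangent has its pole at pi/2, and HOL would give tan (pi/2) = 0; the
   value there is therefore set to infinity explicitly. *)
definition euler_bound ::
    "real \<Rightarrow> real \<Rightarrow> real \<Rightarrow> real \<Rightarrow> real \<Rightarrow> real \<Rightarrow> nat \<Rightarrow> ereal" where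
  "euler_bound a b \<xi> \<beta> \<epsilon> \<eta> k =
     (if k = 0 then \<infinity>
      else if real k < \<xi> * pi / (2 * \<eta> * sqrt (a * b)) then
        ereal (1 / sqrt \<beta> *
          (sqrt (a / b) * tan (pi / 2 - sqrt (a * b) / \<xi> * \<eta> * real k)) powr (\<xi> / 2) + \<epsilon>)
      else ereal \<epsilon>)"

end

theory Submission
  imports Defs "HOL-Complex_Analysis.Great_Picard"
begin

text \<open>
  The step size may depend on the starting point and on \<open>\<epsilon>\<close>, so the estimate is one about the limit
  \<open>\<eta> \<rightarrow> 0\<close>. Euler solutions with steps tending to 0 have a subsequence that converges to a Lipschitz
  curve \<open>X\<close> whose right velocities lie in \<open>F (X t)\<close> (\<open>euler_limit_curve\<close>, \<open>euler_limit_velocity\<close>).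
  If \<open>V\<close> decays along every such curve at the required rate, then a contradiction argument
  transfers the decay, up to an error \<open>\<delta>\<close>, to all Euler solutions with small steps on a bounded time
  horizon (\<open>euler_tracking\<close>).

  Decay along a limit curve is the delicate point, because the hypothesis on \<open>V\<close> speaks only of those
  velocities \<open>v \<in> F x\<close> at which all Clarke gradients \<open>p\<close> give the same value \<open>p \<bullet> v\<close>. Suppose that at
  time \<open>t\<close> both \<open>X\<close> and \<open>V \<circ> X\<close> are differentiable, with derivatives \<open>v\<close> and \<open>\<alpha>\<close>. Regularity
  identifies the generalized directional derivatives of \<open>V\<close> at \<open>X t\<close> in the directions \<open>v\<close> and
  \<open>- v\<close> with \<open>\<alpha>\<close> and \<open>- \<alpha>\<close>; hence \<open>p \<bullet> v = \<alpha>\<close> for every Clarke gradient, and \<open>\<alpha>\<close> belongs to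
  the set-valued derivative. Differentiability almost everywhere would be Rademacher's theorem.
  Less is enough: the forward and backward difference quotients with step \<open>1/2^n\<close> need only become
  equal in the limit, and for Lipschitz curves this follows almost everywhere from the
  parallelogram law (\<open>AE_second_difference_tendsto_0\<close>). Dominated convergence then integrates the
  pointwise bound (\<open>lyapunov_decrease_along_curve\<close>).

  The scalar inequality is solved by the phase \<open>\<theta> = arctan (sqrt (b/a) * V powr (1/\<xi>))\<close>: it turns
  \<open>V' \<le> - (a * V powr (1 - 1/\<xi>) + b * V powr (1 + 1/\<xi>))\<close> into \<open>\<theta>' \<le> - sqrt (a * b) / \<xi>\<close>. As
  \<open>\<theta>\<close> starts below \<open>pi/2\<close> whatever the initial value of \<open>V\<close>, it vanishes by the time
  \<open>\<xi> * pi / (2 * sqrt (a * b))\<close>, and before that \<open>V\<close> is bounded by the tangent expression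
  (\<open>finite_time_decay\<close>).

  To pass to all times, the tracking estimate is restarted: once the settling time has elapsed,
  \<open>V \<le> \<delta>/2\<close>, and tracking from this sublevel set keeps \<open>V < \<delta>\<close> and returns to \<open>V \<le> \<delta>/2\<close> after another
  settling time (\<open>euler_practical_fixed_time_stability\<close>). The bound \<open>V x \<ge> \<beta> * (norm (x - xbar))\<^sup>2\<close>
  converts values of \<open>V\<close> into distances.
\<close>

section \<open>Lipschitz functions of one real variable\<close>

text \<open>
  A substitute for differentiability almost everywhere. Let \<open>E n\<close> be the squared \<open>L\<^sup>2\<close> norm of the
  difference quotient of \<open>f\<close> with step \<open>1/2^n\<close>. Each quotient is the mean of two quotients of half
  the step, so by the parallelogram law \<open>4 * (E (n + 1) - E n)\<close> is the squared \<open>L\<^sup>2\<close> norm of the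
  difference between the forward and the backward quotient. As \<open>E\<close> is bounded, these squared norms
  are summable, and therefore the differences tend to 0 almost everywhere. That \<open>f\<close> is constant
  outside \<open>{0..T}\<close> makes \<open>E\<close> finite and removes boundary terms.
\<close>

lemma AE_second_difference_tendsto_0:
  fixes f :: "real \<Rightarrow> 'a::euclidean_space"
  assumes lip: "L-lipschitz_on UNIV f"
    and left: "\<And>t. t \<le> 0 \<Longrightarrow> f t = f 0" and right: "\<And>t. t \<ge> T \<Longrightarrow> f t = f T"
  shows "AE t in lborel. (\<lambda>n. 2^n *\<^sub>R (f (t + 1/2^n) - f t) - 2^n *\<^sub>R (f t - f (t - 1/2^n))) \<longlonglongrightarrow> 0"
proof -
  define q where "q n t = 2^n *\<^sub>R (f (t + 1/2^n) - f t)" for n t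
  define d where "d n t = q n t - q n (t - 1/2^n)" for n t
  define E where "E n = (\<integral>\<^sup>+t. ennreal ((norm (q n t))\<^sup>2) \<partial>lborel)" for n
  have contf: "continuous_on UNIV f"
    using lip lipschitz_on_continuous_on by blast
  have [measurable]: "f \<in> borel_measurable borel"
    using contf by (rule borel_measurable_continuous_onI)
  have [measurable]: "q n \<in> borel_measurable borel" for n
    unfolding q_def by measurable
  have [measurable]: "d n \<in> borel_measurable borel" for n
    unfolding d_def by measurable
  have qb: "norm (q n t) \<le> L" for n t
  proof -
    have "norm (f (t + 1/2^n) - f t) \<le> L * (1/2^n)"
      using lipschitz_on_normD[OF lip, of "t + 1/2^n" t] by simp
    then have "2^n * norm (f (t + 1/2^n) - f t) \<le> 2^n * (L * (1/2^n))"
      by (intro mult_left_mono) auto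
    then show ?thesis unfolding q_def by simp
  qed
  have q0: "q n t = 0" if "t \<notin> {-1..max T 0}" for n t
  proof -
    have "(1::real)/2^n \<le> 1" by (simp add: divide_le_eq)
    with that consider "t \<le> 0" "t + 1/2^n \<le> 0" | "t \<ge> T" "t + 1/2^n \<ge> T"
      by (fastforce simp: not_le add_increasing2)
    then show ?thesis by cases (metis q_def left right diff_self scaleR_zero_right)+
  qed
  have Eb: "E n \<le> ennreal (L\<^sup>2 * (max T 0 + 1))" for n
  proof -
    have "E n \<le> (\<integral>\<^sup>+t. ennreal (L\<^sup>2) * indicator {-1..max T 0} t \<partial>lborel)"
      unfolding E_def
    proof (rule nn_integral_mono)
      fix t show "ennreal ((norm (q n t))\<^sup>2) \<le> ennreal (L\<^sup>2) * indicator {-1..max T 0} t"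
        using q0[of t n] qb[of n t] by (cases "t \<in> {-1..max T 0}") (auto intro!: power_mono ennreal_leI)
    qed
    also have "\<dots> = ennreal (L\<^sup>2 * (max T 0 + 1))"
      by (simp add: nn_integral_cmult ennreal_mult)
    finally show ?thesis .
  qed
  \<comment> \<open>The quotient with step \<open>1/2^n\<close> at \<open>t - h\<close> is half the sum of the quotients with step \<open>h\<close> at
      \<open>t - h\<close> and at \<open>t\<close>, where \<open>h = 1/2^(n+1)\<close>; their difference is \<open>d\<close>.\<close>
  have par: "(norm (d (Suc n) t))\<^sup>2 + 4 * (norm (q n (t - 1/2^Suc n)))\<^sup>2
      = 2 * (norm (q (Suc n) (t - 1/2^Suc n)))\<^sup>2 + 2 * (norm (q (Suc n) t))\<^sup>2" for n t
  proof -
    define h :: real where "h = 1/2^Suc n"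
    have h2: "1/2^n = h + h" unfolding h_def by simp
    have "2 *\<^sub>R q n (t - h) = q (Suc n) (t - h) + q (Suc n) t"
      unfolding q_def h2 h_def[symmetric] by (simp add: algebra_simps)
    then have "(norm (2 *\<^sub>R q n (t - h)))\<^sup>2 = (norm (q (Suc n) (t - h) + q (Suc n) t))\<^sup>2"
      by simp
    then show ?thesis
      unfolding d_def h_def[symmetric]
      by (simp add: power2_norm_eq_inner inner_simps inner_commute)
  qed
  have shift: "(\<integral>\<^sup>+t. ennreal ((norm (q n (t - h)))\<^sup>2) \<partial>lborel) = E n" for n h
    unfolding E_def
    using nn_integral_real_affine[of "\<lambda>t. ennreal ((norm (q n t))\<^sup>2)" 1 "-h"] by simp
  have step: "(\<integral>\<^sup>+t. ennreal ((norm (d (Suc n) t))\<^sup>2) \<partial>lborel) + 4 * E n = 4 * E (Suc n)" for n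
  proof -
    have "(\<integral>\<^sup>+t. ennreal ((norm (d (Suc n) t))\<^sup>2) \<partial>lborel) + 4 * E n
       = (\<integral>\<^sup>+t. ennreal ((norm (d (Suc n) t))\<^sup>2 + 4 * (norm (q n (t - 1/2^Suc n)))\<^sup>2) \<partial>lborel)"
      by (subst shift[of n "1/2^Suc n", symmetric])
         (simp add: ennreal_plus ennreal_mult nn_integral_add nn_integral_cmult del: power_Suc)
    also have "\<dots> = 2 * E (Suc n) + 2 * E (Suc n)"
      unfolding par
      by (subst (1) shift[of "Suc n" "1/2^Suc n", symmetric], subst E_def)
         (simp add: ennreal_plus ennreal_mult nn_integral_add nn_integral_cmult del: power_Suc)
    also have "\<dots> = 4 * E (Suc n)"
      by (simp flip: distrib_right)
    finally show ?thesis .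
  qed
  have sums: "(\<Sum>i<n. (\<integral>\<^sup>+t. ennreal ((norm (d (Suc i) t))\<^sup>2) \<partial>lborel)) + 4 * E 0 = 4 * E n" for n
    by (induction n) (simp, metis (no_types, lifting) add.assoc add.commute step sum.lessThan_Suc)
  have "(\<integral>\<^sup>+t. (\<Sum>i. ennreal ((norm (d (Suc i) t))\<^sup>2)) \<partial>lborel)
      = (\<Sum>i. (\<integral>\<^sup>+t. ennreal ((norm (d (Suc i) t))\<^sup>2) \<partial>lborel))"
    by (rule nn_integral_suminf) simp
  also have "\<dots> \<le> 4 * ennreal (L\<^sup>2 * (max T 0 + 1))"
  proof (rule suminf_le_const)
    fix n
    have "(\<Sum>i<n. (\<integral>\<^sup>+t. ennreal ((norm (d (Suc i) t))\<^sup>2) \<partial>lborel)) \<le> 4 * E n"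
      using sums[of n] by (metis le_iff_add)
    also have "\<dots> \<le> 4 * ennreal (L\<^sup>2 * (max T 0 + 1))"
      using Eb by (intro mult_left_mono) auto
    finally show "(\<Sum>i<n. (\<integral>\<^sup>+t. ennreal ((norm (d (Suc i) t))\<^sup>2) \<partial>lborel))
        \<le> 4 * ennreal (L\<^sup>2 * (max T 0 + 1))" .
  qed simp
  also have "\<dots> < \<infinity>" by (simp add: ennreal_mult_less_top)
  finally have "AE t in lborel. (\<Sum>i. ennreal ((norm (d (Suc i) t))\<^sup>2)) \<noteq> \<infinity>"
    by (intro nn_integral_PInf_AE) auto
  then show ?thesis
  proof eventually_elim
    case (elim t)
    then have "summable (\<lambda>i. (norm (d (Suc i) t))\<^sup>2)"
      by (intro summable_suminf_not_top) auto
    then have "(\<lambda>i. (norm (d (Suc i) t))\<^sup>2) \<longlonglongrightarrow> 0"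
      by (rule summable_LIMSEQ_zero)
    then have "(\<lambda>i. sqrt ((norm (d (Suc i) t))\<^sup>2)) \<longlonglongrightarrow> 0"
      using tendsto_real_sqrt by fastforce
    then have "(\<lambda>i. d (Suc i) t) \<longlonglongrightarrow> 0"
      by (simp add: tendsto_norm_zero_iff)
    then have "(\<lambda>i. d i t) \<longlonglongrightarrow> 0" by (rule LIMSEQ_imp_Suc)
    then show ?case by (simp add: d_def q_def)
  qed
qed

text \<open>
  A pointwise bound on the upper limit of difference quotients may be integrated: the quotients
  are uniformly bounded, so the integral of their positive excess over \<open>- m\<close> tends to 0 by dominated
  convergence, while the integral of the quotients themselves tends to the increment of \<open>g\<close>.
\<close>

lemma increment_le_of_AE_quotient_bound:
  fixes g :: "real \<Rightarrow> real"
  assumes lip: "K-lipschitz_on UNIV g" and "t0 \<le> t1"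
    and ae: "AE t in lborel. t \<in> {t0<..<t1} \<longrightarrow> (\<lambda>n. max 0 (2^n * (g (t + 1/2^n) - g t) + m)) \<longlonglongrightarrow> 0"
  shows "g t1 \<le> g t0 - m * (t1 - t0)"
proof -
  define q where "q n t = 2^n * (g (t + 1/2^n) - g t) + m" for n t
  have contg: "continuous_on UNIV g"
    using lip lipschitz_on_continuous_on by blast
  have contq: "continuous_on UNIV (q n)" for n
    unfolding q_def by (intro continuous_intros continuous_on_compose2[OF contg]) auto
  have [measurable]: "q n \<in> borel_measurable borel" for n
    using contq by (rule borel_measurable_continuous_onI)
  have qb: "\<bar>q n t\<bar> \<le> K + \<bar>m\<bar>" for n t
  proof -
    have "\<bar>g (t + 1/2^n) - g t\<bar> \<le> K * (1/2^n)"
      using lipschitz_on_normD[OF lip, of "t + 1/2^n" t] by simp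
    then have "2^n * \<bar>g (t + 1/2^n) - g t\<bar> \<le> 2^n * (K * (1/2^n))"
      by (intro mult_left_mono) auto
    then have "\<bar>2^n * (g (t + 1/2^n) - g t)\<bar> \<le> K" by (simp add: abs_mult)
    then show ?thesis unfolding q_def by linarith
  qed
  \<comment> \<open>An antiderivative of \<open>g\<close> on a larger interval, which contains \<open>t + 1/2^n\<close> for all \<open>t\<close> in
      \<open>{t0..t1}\<close>, evaluates the integral of a difference quotient in closed form.\<close>
  obtain P where P: "\<And>x. x \<in> {t0-1..t1+2} \<Longrightarrow> (P has_vector_derivative g x) (at x within {t0-1..t1+2})"
    using antiderivative_continuous[of "t0-1" "t1+2" g] contg continuous_on_subset by blast
  have DP: "(P has_real_derivative g x) (at x)" if "t0 - 1 < x" "x < t1 + 2" for x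
    using P[of x] that
    by (simp add: has_real_derivative_iff_has_vector_derivative at_within_Icc_at)
  have half: "(\<lambda>n. 1/2^n :: real) \<longlonglongrightarrow> 0"
    by (rule LIMSEQ_divide_realpow_zero) simp
  have half_at: "filterlim (\<lambda>n. 1/2^n :: real) (at 0) sequentially"
    using half by (simp add: filterlim_at)
  have quot: "(\<lambda>n. 2^n * (P (s + 1/2^n) - P s)) \<longlonglongrightarrow> g s" if "t0 - 1 < s" "s < t1 + 2" for s
  proof -
    have "(\<lambda>h. (P (s + h) - P s) / h) \<midarrow>0\<rightarrow> g s"
      using DP[OF that] by (simp add: DERIV_def)
    from filterlim_compose[OF this half_at]
    show ?thesis by (simp add: mult.commute)
  qed
  define A where "A n t = 2^n * (P (t + 1/2^n) - P t) + m * t" for n t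
  have le1: "1/2^n \<le> (1::real)" "1/2^n > (0::real)" for n by (simp_all add: divide_le_eq)
  have DA: "(A n has_real_derivative q n x) (at x)" if "t0 \<le> x" "x \<le> t1" for n x
  proof -
    have "((\<lambda>t. P (t + 1/2^n)) has_real_derivative g (x + 1/2^n)) (at x)"
      using DP[of "x + 1/2^n"] that le1[of n] by (simp add: DERIV_shift)
    moreover have "(P has_real_derivative g x) (at x)"
      using DP that by auto
    ultimately show ?thesis
      unfolding A_def q_def by (auto intro!: derivative_eq_intros)
  qed
  have int: "(\<integral>t. q n t * indicator {t0..t1} t \<partial>lborel) = A n t1 - A n t0" for n
    using contq[of n] by (intro integral_FTC_Icc_real DA assms)
       (auto simp: continuous_on_eq_continuous_at)
  have lim1: "(\<lambda>n. A n t1 - A n t0) \<longlonglongrightarrow> (g t1 + m * t1) - (g t0 + m * t0)"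
    unfolding A_def using \<open>t0 \<le> t1\<close> by (intro tendsto_intros quot) auto
  have dom: "(\<lambda>n. \<integral>t. max 0 (q n t) * indicator {t0<..<t1} t \<partial>lborel) \<longlonglongrightarrow> (\<integral>t. 0 \<partial>(lborel::real measure))"
  proof (rule integral_dominated_convergence[where w="\<lambda>t. (K + \<bar>m\<bar>) * indicator {t0..t1} t"])
    show "AE t in lborel. (\<lambda>n. max 0 (q n t) * indicator {t0<..<t1} t) \<longlonglongrightarrow> 0"
      using ae by eventually_elim (auto simp: q_def indicator_def)
    show "AE t in lborel. norm (max 0 (q n t) * indicator {t0<..<t1} t) \<le> (K + \<bar>m\<bar>) * indicator {t0..t1} t" for n
    proof (rule AE_I2)
      fix t show "norm (max 0 (q n t) * indicator {t0<..<t1} t) \<le> (K + \<bar>m\<bar>) * indicator {t0..t1} t"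
        using qb[of n t] by (auto simp: indicator_def)
    qed
  qed (auto intro!: integrable_mult_right integrable_real_indicator simp: emeasure_lborel_Icc_eq)
  have le: "A n t1 - A n t0 \<le> (\<integral>t. max 0 (q n t) * indicator {t0<..<t1} t \<partial>lborel)" for n
    unfolding int[symmetric]
  proof (rule integral_mono_AE)
    have bnd: "set_integrable lborel {t0..t1} f \<Longrightarrow> integrable lborel (\<lambda>t. f t * indicator {t0..t1} t)"
      for f :: "real \<Rightarrow> real"
      by (simp add: set_integrable_def mult.commute)
    show "integrable lborel (\<lambda>t. q n t * indicator {t0..t1} t)"
      by (intro bnd borel_integrable_atLeastAtMost' continuous_on_subset[OF contq]) auto
    show "integrable lborel (\<lambda>t. max 0 (q n t) * indicator {t0<..<t1} t)"
    proof (rule Bochner_Integration.integrable_bound[where f="\<lambda>t. (K + \<bar>m\<bar>) * indicator {t0..t1} t"])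
      show "AE t in lborel. norm (max 0 (q n t) * indicator {t0<..<t1} t) \<le> norm ((K + \<bar>m\<bar>) * indicator {t0..t1} t)"
      proof (rule AE_I2)
        fix t show "norm (max 0 (q n t) * indicator {t0<..<t1} t) \<le> norm ((K + \<bar>m\<bar>) * indicator {t0..t1} t)"
          using qb[of n t] by (auto simp: indicator_def)
      qed
    qed (auto intro!: integrable_mult_right integrable_real_indicator simp: emeasure_lborel_Icc_eq)
    have "AE t in lborel. t \<noteq> t0 \<and> t \<noteq> t1"
      by (intro AE_conjI AE_lborel_singleton)
    then show "AE t in lborel. q n t * indicator {t0..t1} t \<le> max 0 (q n t) * indicator {t0<..<t1} t"
      by eventually_elim (auto simp: indicator_def)
  qed
  have "(g t1 + m * t1) - (g t0 + m * t0) \<le> (\<integral>t. 0 \<partial>(lborel::real measure))"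
    by (rule LIMSEQ_le[OF lim1 dom]) (use le in auto)
  then show ?thesis by (simp add: algebra_simps)
qed

section \<open>Clarke derivatives along curves\<close>

text \<open>
  Difference quotients along an arc \<open>y + h n *\<^sub>R w n\<close> with \<open>w n \<longlonglongrightarrow> v\<close> differ from those along the
  ray in direction \<open>v\<close> by at most \<open>L * norm (w n - v)\<close>, and on the ray regularity applies.
\<close>

lemma clarke_dir_deriv_eq_sequential_limit:
  fixes V :: "'a::real_normed_vector \<Rightarrow> real"
  assumes V_lipschitz: "locally_lipschitz V" and V_regular: "clarke_regular V"
    and h: "filterlim h (at_right 0) sequentially" and w: "w \<longlonglongrightarrow> v"
    and lim: "(\<lambda>n. (V (y + h n *\<^sub>R w n) - V y) / h n) \<longlonglongrightarrow> \<alpha>"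
  shows "clarke_dir_deriv V y v = ereal \<alpha>"
proof -
  obtain d where d: "((\<lambda>h. (V (y + h *\<^sub>R v) - V y) / h) \<longlongrightarrow> d) (at_right 0)"
    and dd: "ereal d = clarke_dir_deriv V y v"
    using V_regular unfolding clarke_regular_def by blast
  obtain u L where u: "u > 0" and L: "L-lipschitz_on (ball y u) V"
    using V_lipschitz unfolding locally_lipschitz_def by blast
  have h0: "h \<longlonglongrightarrow> 0" and hpos: "\<forall>\<^sub>F n in sequentially. h n > 0"
    using h by (auto simp: filterlim_at elim!: eventually_mono)
  have A: "(\<lambda>n. (V (y + h n *\<^sub>R v) - V y) / h n) \<longlonglongrightarrow> d"
    using filterlim_compose[OF d h] .
  have "(\<lambda>n. y + h n *\<^sub>R w n) \<longlonglongrightarrow> y + 0 *\<^sub>R v" "(\<lambda>n. y + h n *\<^sub>R v) \<longlonglongrightarrow> y + 0 *\<^sub>R v"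
    by (intro tendsto_intros h0 w)+
  then have "\<forall>\<^sub>F n in sequentially. y + h n *\<^sub>R w n \<in> ball y u"
    and "\<forall>\<^sub>F n in sequentially. y + h n *\<^sub>R v \<in> ball y u"
    using u by (auto simp: tendsto_iff dist_commute)
  with hpos have bound: "\<forall>\<^sub>F n in sequentially.
      norm ((V (y + h n *\<^sub>R w n) - V y) / h n - (V (y + h n *\<^sub>R v) - V y) / h n) \<le> L * norm (w n - v)"
  proof eventually_elim
    case (elim n)
    have "\<bar>V (y + h n *\<^sub>R w n) - V (y + h n *\<^sub>R v)\<bar> \<le> L * norm ((y + h n *\<^sub>R w n) - (y + h n *\<^sub>R v))"
      using lipschitz_on_normD[OF L elim(2,3)] by simp
    also have "(y + h n *\<^sub>R w n) - (y + h n *\<^sub>R v) = h n *\<^sub>R (w n - v)"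
      by (simp add: scaleR_diff_right)
    finally have "\<bar>V (y + h n *\<^sub>R w n) - V (y + h n *\<^sub>R v)\<bar> \<le> h n * (L * norm (w n - v))"
      using elim(1) by (simp add: mult_ac)
    then show ?case
      using elim(1) by (simp add: diff_divide_distrib[symmetric] divide_le_eq mult.commute)
  qed
  have "(\<lambda>n. L * norm (w n - v)) \<longlonglongrightarrow> L * norm (v - v)"
    by (intro tendsto_intros w)
  then have "(\<lambda>n. L * norm (w n - v)) \<longlonglongrightarrow> 0" by simp
  from Lim_null_comparison[OF bound this]
  have "(\<lambda>n. (V (y + h n *\<^sub>R w n) - V y) / h n - (V (y + h n *\<^sub>R v) - V y) / h n) \<longlonglongrightarrow> 0" .
  from tendsto_add[OF this A] have "(\<lambda>n. (V (y + h n *\<^sub>R w n) - V y) / h n) \<longlonglongrightarrow> d" by simp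
  with lim have "\<alpha> = d" using LIMSEQ_unique by blast
  with dd show ?thesis by simp
qed

text \<open>
  If the forward quotients along directions tending to \<open>v\<close> and the backward quotients have the
  same limit \<open>\<alpha>\<close>, then the support function of the Clarke gradient is \<open>\<alpha>\<close> at \<open>v\<close> and \<open>- \<alpha>\<close> at \<open>- v\<close>.
  This squeezes \<open>p \<bullet> v\<close> for every \<open>p\<close> in the gradient.
\<close>

lemma clarke_gradient_inner_eq:
  fixes V :: "'a::real_inner \<Rightarrow> real"
  assumes V_lipschitz: "locally_lipschitz V" and V_regular: "clarke_regular V"
    and h: "filterlim h (at_right 0) sequentially"
    and w: "w \<longlonglongrightarrow> v" and u: "u \<longlonglongrightarrow> v"
    and fwd: "(\<lambda>n. (V (y + h n *\<^sub>R w n) - V y) / h n) \<longlonglongrightarrow> \<alpha>"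
    and bwd: "(\<lambda>n. (V y - V (y - h n *\<^sub>R u n)) / h n) \<longlonglongrightarrow> \<alpha>"
    and p: "p \<in> clarke_gradient V y"
  shows "p \<bullet> v = \<alpha>"
proof -
  have 1: "clarke_dir_deriv V y v = ereal \<alpha>"
    by (rule clarke_dir_deriv_eq_sequential_limit[OF V_lipschitz V_regular h w fwd])
  have "(\<lambda>n. - ((V y - V (y - h n *\<^sub>R u n)) / h n)) \<longlonglongrightarrow> - \<alpha>"
    by (intro tendsto_intros bwd)
  then have "(\<lambda>n. (V (y + h n *\<^sub>R (- u n)) - V y) / h n) \<longlonglongrightarrow> - \<alpha>"
    by (simp add: minus_divide_left)
  then have 2: "clarke_dir_deriv V y (- v) = ereal (- \<alpha>)"
    by (intro clarke_dir_deriv_eq_sequential_limit[OF V_lipschitz V_regular h tendsto_minus[OF u]])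
  have "ereal (p \<bullet> v) \<le> ereal \<alpha>" "ereal (p \<bullet> (- v)) \<le> ereal (- \<alpha>)"
    using p unfolding clarke_gradient_def 1[symmetric] 2[symmetric] by blast+
  then show ?thesis by simp
qed

lemma locally_lipschitz_on_compact:
  assumes "locally_lipschitz f" "compact S"
  obtains K where "K-lipschitz_on S f"
proof -
  have "local_lipschitz {0::real} S (\<lambda>_. f)"
  proof (rule local_lipschitzI)
    fix x assume "x \<in> S"
    obtain u L where u: "u > 0" and L: "L-lipschitz_on (ball x u) f"
      using assms(1) unfolding locally_lipschitz_def by blast
    have "cball x (u/2) \<inter> S \<subseteq> ball x u" using u by auto
    then have "L-lipschitz_on (cball x (u/2) \<inter> S) f"
      by (rule lipschitz_on_subset[OF L])
    with u show "\<exists>u>0. \<exists>L. \<forall>t\<in>cball t u \<inter> {0}. L-lipschitz_on (cball x u \<inter> S) f" for t :: real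
      by (intro exI[of _ "u/2"]) auto
  qed
  then show thesis
    by (rule local_lipschitz_compact_implies_lipschitz[of "{0::real}" S "\<lambda>_. f"])
       (use assms(2) that in auto)
qed

text \<open>
  At \<open>xbar\<close>, where nothing is known about the set-valued derivative, the claim \<open>\<alpha> \<le> 0\<close> holds because
  \<open>V\<close> is minimal there, so that the backward quotients are nonpositive.
\<close>

lemma derivative_limit_le_along_curve:
  fixes F :: "'a::real_inner \<Rightarrow> 'a set" and V :: "'a \<Rightarrow> real"
  assumes V_lipschitz: "locally_lipschitz V" and V_regular: "clarke_regular V"
    and V_nonneg: "\<And>y. V y \<ge> 0" and V_xbar: "V xbar = 0" and c0: "c 0 = 0"
    and V_decrease: "\<And>y. y \<noteq> xbar \<Longrightarrow> (SUP l \<in> set_valued_derivative F V y. ereal l) \<le> ereal (- c (V y))"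
    and h: "filterlim h (at_right 0) sequentially"
    and w: "w \<longlonglongrightarrow> v" and u: "u \<longlonglongrightarrow> v" and v: "v \<in> F y"
    and fwd: "(\<lambda>n. (V (y + h n *\<^sub>R w n) - V y) / h n) \<longlonglongrightarrow> \<alpha>"
    and bwd: "(\<lambda>n. (V y - V (y - h n *\<^sub>R u n)) / h n) \<longlonglongrightarrow> \<alpha>"
  shows "\<alpha> \<le> - c (V y)"
proof (cases "y = xbar")
  case True
  have "\<forall>\<^sub>F n in sequentially. h n > 0"
    using h by (auto simp: filterlim_at elim!: eventually_mono)
  then have "\<forall>\<^sub>F n in sequentially. (V y - V (y - h n *\<^sub>R u n)) / h n \<le> 0"
    by eventually_elim (use True V_xbar V_nonneg in \<open>auto simp: divide_le_0_iff\<close>)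
  then have "\<alpha> \<le> 0"
    by (intro tendsto_upperbound[OF bwd]) auto
  then show ?thesis using True V_xbar c0 by simp
next
  case False
  have "\<alpha> \<in> set_valued_derivative F V y"
    unfolding set_valued_derivative_def
    using v clarke_gradient_inner_eq[OF V_lipschitz V_regular h w u fwd bwd] by blast
  then have "ereal \<alpha> \<le> (SUP l \<in> set_valued_derivative F V y. ereal l)"
    by (intro SUP_upper)
  also have "\<dots> \<le> ereal (- c (V y))" using V_decrease[OF False] .
  finally show ?thesis by simp
qed

text \<open>
  Combines the pointwise bound with the almost everywhere agreement of forward and backward
  quotients. The lower bound \<open>m\<close> on the decay rate is a parameter: \<open>m = 0\<close> gives monotonicity of \<open>V\<close>
  along the curve, which then justifies taking for \<open>m\<close> the rate at the right end point.
\<close>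

lemma lyapunov_decrease_along_curve:
  fixes F :: "'a::euclidean_space \<Rightarrow> 'a set" and V :: "'a \<Rightarrow> real" and x :: "real \<Rightarrow> 'a"
  assumes V_lipschitz: "locally_lipschitz V" and V_regular: "clarke_regular V"
    and V_nonneg: "\<And>y. V y \<ge> 0" and V_xbar: "V xbar = 0" and c0: "c 0 = 0"
    and V_decrease: "\<And>y. y \<noteq> xbar \<Longrightarrow> (SUP l \<in> set_valued_derivative F V y. ereal l) \<le> ereal (- c (V y))"
    and x_lip: "M-lipschitz_on {0..T} x"
    and velocity: "\<And>t h v. 0 < t \<Longrightarrow> t < T \<Longrightarrow> filterlim h (at_right 0) sequentially \<Longrightarrow>
       (\<lambda>n. (x (t + h n) - x t) /\<^sub>R h n) \<longlonglongrightarrow> v \<Longrightarrow> v \<in> F (x t)"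
    and t01: "0 \<le> t0" "t0 \<le> t1" "t1 \<le> T"
    and m: "\<And>s. t0 < s \<Longrightarrow> s < t1 \<Longrightarrow> m \<le> c (V (x s))"
  shows "V (x t1) \<le> V (x t0) - m * (t1 - t0)"
proof -
  \<comment> \<open>Clamping the time to \<open>{0..T}\<close> yields a Lipschitz curve on the whole line that is constant
      outside this interval and has a compact range, on which \<open>V\<close> is Lipschitz.\<close>
  define cl where "cl t = max 0 (min T t)" for t :: real
  define X where "X t = x (cl t)" for t
  define g where "g t = V (X t)" for t
  have T0: "0 \<le> T" using t01 by simp
  have cl_in: "cl t \<in> {0..T}" for t using T0 by (auto simp: cl_def)
  have X_lip: "M-lipschitz_on UNIV X"
  proof (rule lipschitz_onI)
    show "M \<ge> 0" using x_lip lipschitz_on_nonneg by blast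
    fix s t
    have "dist (X s) (X t) \<le> M * dist (cl s) (cl t)"
      unfolding X_def by (rule lipschitz_onD[OF x_lip cl_in cl_in])
    also have "\<dots> \<le> M * dist s t"
      using \<open>M \<ge> 0\<close> by (intro mult_left_mono) (auto simp: cl_def dist_real_def)
    finally show "dist (X s) (X t) \<le> M * dist s t" .
  qed
  have "compact (x ` {0..T})"
    using x_lip by (intro compact_continuous_image lipschitz_on_continuous_on) auto
  then obtain K where "K-lipschitz_on (x ` {0..T}) V"
    using locally_lipschitz_on_compact[OF V_lipschitz] by blast
  then have "K-lipschitz_on (range X) V"
    by (rule lipschitz_on_subset) (use cl_in in \<open>auto simp: X_def\<close>)
  then have g_lip: "(K * M)-lipschitz_on UNIV g"
    unfolding g_def using lipschitz_on_compose2[OF X_lip] by blast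
  define wX where "wX n t = 2^n *\<^sub>R (X (t + 1/2^n) - X t)" for n t
  define uX where "uX n t = 2^n *\<^sub>R (X t - X (t - 1/2^n))" for n t
  define wg where "wg n t = 2^n * (g (t + 1/2^n) - g t)" for n t
  define ug where "ug n t = 2^n * (g t - g (t - 1/2^n))" for n t
  have aeX: "AE t in lborel. (\<lambda>n. wX n t - uX n t) \<longlonglongrightarrow> 0"
    unfolding wX_def uX_def
    by (rule AE_second_difference_tendsto_0[OF X_lip, where T=T]) (use T0 in \<open>auto simp: X_def cl_def\<close>)
  have aeg: "AE t in lborel. (\<lambda>n. wg n t - ug n t) \<longlonglongrightarrow> 0"
    using AE_second_difference_tendsto_0[OF g_lip, where T=T] T0
    unfolding wg_def ug_def by (auto simp: g_def X_def cl_def)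
  have wX_bound: "norm (wX n t) \<le> M" for n t
  proof -
    have "norm (X (t + 1/2^n) - X t) \<le> M * (1/2^n)"
      using lipschitz_on_normD[OF X_lip, of "t + 1/2^n" t] by simp
    then have "2^n * norm (X (t + 1/2^n) - X t) \<le> 2^n * (M * (1/2^n))"
      by (intro mult_left_mono) auto
    then show ?thesis unfolding wX_def by simp
  qed
  have wg_bound: "norm (wg n t) \<le> K * M" for n t
  proof -
    have "\<bar>g (t + 1/2^n) - g t\<bar> \<le> K * M * (1/2^n)"
      using lipschitz_on_normD[OF g_lip, of "t + 1/2^n" t] by simp
    then have "2^n * \<bar>g (t + 1/2^n) - g t\<bar> \<le> 2^n * (K * M * (1/2^n))"
      by (intro mult_left_mono) auto
    then show ?thesis unfolding wg_def by (simp add: abs_mult)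
  qed
  have limit: "(\<lambda>n. max 0 (wg n t + m)) \<longlonglongrightarrow> 0"
    if t: "t0 < t" "t < t1" and dX: "(\<lambda>n. wX n t - uX n t) \<longlonglongrightarrow> 0"
      and dg: "(\<lambda>n. wg n t - ug n t) \<longlonglongrightarrow> 0" for t
  proof (rule ccontr)
    assume "\<not> ?thesis"
    then obtain e where e: "e > 0" and ne: "\<not> (\<forall>\<^sub>F n in sequentially. \<bar>max 0 (wg n t + m)\<bar> < e)"
      by (auto simp: tendsto_iff)
    from ne e have "\<exists>\<^sub>F n in sequentially. wg n t + m \<ge> e"
      unfolding not_eventually by (auto elim!: frequently_elim1 simp: max_def split: if_splits)
    then have "infinite {n. wg n t + m \<ge> e}"
      by (simp add: frequently_cofinite[symmetric] cofinite_eq_sequentially)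
    from infinite_enumerate[OF this] obtain r :: "nat \<Rightarrow> nat" where r: "strict_mono r"
      and re: "\<And>n. wg (r n) t + m \<ge> e" by auto
    \<comment> \<open>Pass to a subsequence along which the quotients of the curve and of \<open>V\<close> converge together;
        the backward quotients then have the same limits.\<close>
    have "bounded (range (\<lambda>n. (wX (r n) t, wg (r n) t)))"
    proof (rule boundedI)
      fix z assume "z \<in> range (\<lambda>n. (wX (r n) t, wg (r n) t))"
      then obtain n where "z = (wX (r n) t, wg (r n) t)" by blast
      then show "norm z \<le> M + K * M"
        using norm_Pair_le[of "wX (r n) t" "wg (r n) t"] wX_bound[of "r n" t] wg_bound[of "r n" t] by simp
    qed
    then obtain z s where s: "strict_mono (s::nat\<Rightarrow>nat)"
      and z: "((\<lambda>n. (wX (r n) t, wg (r n) t)) \<circ> s) \<longlonglongrightarrow> z"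
      using bounded_imp_convergent_subsequence by blast
    define \<rho> where "\<rho> = r \<circ> s"
    have \<rho>: "strict_mono \<rho>" unfolding \<rho>_def using r s strict_mono_o by blast
    obtain v \<alpha> where zv: "z = (v, \<alpha>)" by (cases z)
    have lw: "(\<lambda>n. wX (\<rho> n) t) \<longlonglongrightarrow> v" and lg: "(\<lambda>n. wg (\<rho> n) t) \<longlonglongrightarrow> \<alpha>"
      using tendsto_fst[OF z] tendsto_snd[OF z] by (simp_all add: \<rho>_def zv o_def)
    have lu: "(\<lambda>n. uX (\<rho> n) t) \<longlonglongrightarrow> v"
      using tendsto_diff[OF lw LIMSEQ_subseq_LIMSEQ[OF dX \<rho>]] by (simp add: o_def)
    have lug: "(\<lambda>n. ug (\<rho> n) t) \<longlonglongrightarrow> \<alpha>"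
      using tendsto_diff[OF lg LIMSEQ_subseq_LIMSEQ[OF dg \<rho>]] by (simp add: o_def)
    define h :: "nat \<Rightarrow> real" where "h n = 1 / 2 ^ \<rho> n" for n
    have hpos: "h n > 0" for n by (simp add: h_def)
    have "(\<lambda>n. 1/2^n :: real) \<longlonglongrightarrow> 0"
      by (rule LIMSEQ_divide_realpow_zero) simp
    from LIMSEQ_subseq_LIMSEQ[OF this \<rho>] have h0: "h \<longlonglongrightarrow> 0" by (simp add: h_def[abs_def] o_def)
    then have h: "filterlim h (at_right 0) sequentially"
      using hpos by (auto simp: filterlim_at intro!: always_eventually less_imp_neq[symmetric])
    have Xt: "X t = x t" using t t01 by (simp add: X_def cl_def)
    have "\<forall>\<^sub>F n in sequentially. h n < t1 - t"
      using h0 t by (intro order_tendstoD(2)[OF h0]) auto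
    then have "\<forall>\<^sub>F n in sequentially. wX (\<rho> n) t = (x (t + h n) - x t) /\<^sub>R h n"
    proof eventually_elim
      case (elim n)
      have "X (t + h n) = x (t + h n)" using elim t t01 hpos[of n] by (simp add: X_def cl_def)
      then show ?case by (simp add: wX_def h_def Xt)
    qed
    with lw have "(\<lambda>n. (x (t + h n) - x t) /\<^sub>R h n) \<longlonglongrightarrow> v"
      by (rule Lim_transform_eventually)
    then have v: "v \<in> F (X t)"
      unfolding Xt using velocity[OF _ _ h] t t01 by simp
    have "\<alpha> \<le> - c (V (X t))"
    proof (rule derivative_limit_le_along_curve[OF V_lipschitz V_regular V_nonneg V_xbar c0 V_decrease h lw lu v])
      have "X t + h n *\<^sub>R wX (\<rho> n) t = X (t + h n)" for n
        by (simp add: wX_def h_def)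
      then show "(\<lambda>n. (V (X t + h n *\<^sub>R wX (\<rho> n) t) - V (X t)) / h n) \<longlonglongrightarrow> \<alpha>"
        using lg by (simp add: wg_def g_def h_def mult.commute)
      have "X t - h n *\<^sub>R uX (\<rho> n) t = X (t - h n)" for n
        by (simp add: uX_def h_def)
      then show "(\<lambda>n. (V (X t) - V (X t - h n *\<^sub>R uX (\<rho> n) t)) / h n) \<longlonglongrightarrow> \<alpha>"
        using lug by (simp add: ug_def g_def h_def mult.commute)
    qed
    also have "- c (V (X t)) \<le> - m" using m[of t] t by (simp add: Xt)
    finally have "\<alpha> \<le> - m" .
    moreover have "e - m \<le> \<alpha>"
      by (rule tendsto_lowerbound[OF lg]) (use re in \<open>auto simp: \<rho>_def algebra_simps\<close>)
    ultimately show False using e by simp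
  qed
  have "AE t in lborel. t \<in> {t0<..<t1} \<longrightarrow> (\<lambda>n. max 0 (2^n * (g (t + 1/2^n) - g t) + m)) \<longlonglongrightarrow> 0"
    using aeX aeg by eventually_elim (use limit in \<open>auto simp: wg_def\<close>)
  from increment_le_of_AE_quotient_bound[OF g_lip t01(2) this]
  have "g t1 \<le> g t0 - m * (t1 - t0)" .
  then show ?thesis using t01 by (simp add: g_def X_def cl_def)
qed

section \<open>The scalar decay estimate\<close>

text \<open>
  The hypothesis on \<open>g\<close> is an implicit Euler inequality for \<open>g' = - c g\<close>. By the mean value theorem,
  a step of length \<open>\<Delta>\<close> lowers \<open>\<Theta> (g s)\<close> by at least \<open>\<kappa> * \<Delta>\<close> times the ratio of the
  values of \<open>c\<close> after and before the step. Bounding each ratio \<open>r\<close> below by \<open>1 + ln r\<close> makes the loss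
  telescope: over \<open>N\<close> equal steps it amounts to a multiple of \<open>1/N\<close>.
\<close>

lemma decrease_comparison:
  fixes c \<Theta> g :: "real \<Rightarrow> real"
  assumes c_pos: "\<And>y. y > 0 \<Longrightarrow> c y > 0"
    and c_mono: "\<And>y z. 0 < y \<Longrightarrow> y \<le> z \<Longrightarrow> c y \<le> c z"
    and deriv: "\<And>y. y > 0 \<Longrightarrow> (\<Theta> has_real_derivative \<kappa> / c y) (at y)"
    and \<kappa>: "\<kappa> \<ge> 0" and t: "t \<ge> 0"
    and g_pos: "\<And>s. 0 \<le> s \<Longrightarrow> s \<le> t \<Longrightarrow> g s > 0"
    and dec: "\<And>s s'. 0 \<le> s \<Longrightarrow> s \<le> s' \<Longrightarrow> s' \<le> t \<Longrightarrow> g s' \<le> g s - (s' - s) * c (g s')"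
  shows "\<Theta> (g t) \<le> \<Theta> (g 0) - \<kappa> * t"
proof -
  have step: "\<Theta> (g s') \<le> \<Theta> (g s) - \<kappa> * (s' - s) * (1 + ln (c (g s')) - ln (c (g s)))"
    if s: "0 \<le> s" "s \<le> s'" "s' \<le> t" for s s'
  proof -
    have gs: "g s > 0" "g s' > 0" using g_pos s by auto
    have cs: "c (g s) > 0" "c (g s') > 0" using c_pos gs by auto
    have d: "(s' - s) * c (g s') \<le> g s - g s'" using dec[OF s] by simp
    have d0: "0 \<le> (s' - s) * c (g s')" using cs s by simp
    have "(g s - g s') * (\<kappa> / c (g s)) \<le> \<Theta> (g s) - \<Theta> (g s')"
    proof (cases "g s' < g s")
      case True
      then obtain z where z: "g s' < z" "z < g s"
        and eq: "\<Theta> (g s) - \<Theta> (g s') = (g s - g s') * (\<kappa> / c z)"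
        using MVT2[of "g s'" "g s" \<Theta> "\<lambda>y. \<kappa> / c y"] deriv gs by force
      have "c z \<le> c (g s)" "c z > 0" using c_mono c_pos z gs by auto
      then have "\<kappa> / c (g s) \<le> \<kappa> / c z" using \<kappa> by (intro divide_left_mono) auto
      then show ?thesis unfolding eq using True by (intro mult_left_mono) auto
    next
      case False
      then have "g s = g s'" using d d0 by linarith
      then show ?thesis by simp
    qed
    moreover have "(s' - s) * c (g s') * (\<kappa> / c (g s)) \<le> (g s - g s') * (\<kappa> / c (g s))"
      using d \<kappa> cs by (intro mult_right_mono) auto
    moreover have "1 + ln (c (g s')) - ln (c (g s)) \<le> c (g s') / c (g s)"
      using ln_le_minus_one[of "c (g s') / c (g s)"] cs by (simp add: ln_div)
    then have "\<kappa> * (s' - s) * (1 + ln (c (g s')) - ln (c (g s))) \<le> \<kappa> * (s' - s) * (c (g s') / c (g s))"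
      using \<kappa> s by (intro mult_left_mono) auto
    ultimately show ?thesis by (simp add: mult_ac)
  qed
  define R where "R = ln (c (g t)) - ln (c (g 0))"
  have main: "\<Theta> (g t) \<le> \<Theta> (g 0) - \<kappa> * t - \<kappa> * t * R / real (Suc n)" for n
  proof -
    define N where "N = Suc n"
    define s where "s j = t * real j / real N" for j
    have N: "real N > 0" unfolding N_def by simp
    have s_Suc: "s (Suc j) - s j = t / real N" for j
      unfolding s_def by (simp add: distrib_left add_divide_distrib)
    have "\<Theta> (g (s j)) \<le> \<Theta> (g 0) - \<kappa> * (t / real N) * (real j + ln (c (g (s j))) - ln (c (g 0)))"
      if "j \<le> N" for j
      using that
    proof (induction j)
      case 0 show ?case by (simp add: s_def)
    next
      case (Suc j)
      have sN: "s N = t" using N by (simp add: s_def)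
      have mono: "i \<le> k \<Longrightarrow> s i \<le> s k" for i k
        unfolding s_def using t by (intro divide_right_mono mult_left_mono) auto
      have "0 \<le> s j" unfolding s_def using t by simp
      moreover have "s j \<le> s (Suc j)" "s (Suc j) \<le> t" using mono[of "Suc j" N] mono[of j "Suc j"] Suc.prems sN by auto
      ultimately have "\<Theta> (g (s (Suc j))) \<le> \<Theta> (g (s j)) - \<kappa> * (s (Suc j) - s j) * (1 + ln (c (g (s (Suc j)))) - ln (c (g (s j))))"
        by (rule step)
      then show ?case using Suc unfolding s_Suc by (simp add: algebra_simps)
    qed
    from this[of N] N show ?thesis
      unfolding R_def N_def[symmetric] by (simp add: s_def field_simps)
  qed
  have "(\<lambda>n. \<Theta> (g 0) - \<kappa> * t - \<kappa> * t * R / real (Suc n)) \<longlonglongrightarrow> \<Theta> (g 0) - \<kappa> * t - 0"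
    by (intro tendsto_intros LIMSEQ_Suc lim_const_over_n)
  from LIMSEQ_le_const[OF this] show ?thesis using main by fastforce
qed

definition decay_rate :: "real \<Rightarrow> real \<Rightarrow> real \<Rightarrow> real \<Rightarrow> real" where
  "decay_rate a b \<xi> y = a * y powr (1 - 1 / \<xi>) + b * y powr (1 + 1 / \<xi>)"

definition decay_phase :: "real \<Rightarrow> real \<Rightarrow> real \<Rightarrow> real \<Rightarrow> real" where
  "decay_phase a b \<xi> y = arctan (sqrt (b / a) * y powr (1 / \<xi>))"

text \<open>
  The inverse of \<open>decay_phase\<close> on \<open>{0..<pi/2}\<close>, extended by 0 to negative phases, so that it also
  describes a solution that has come to rest.
\<close>

definition phase_level :: "real \<Rightarrow> real \<Rightarrow> real \<Rightarrow> real \<Rightarrow> real" where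
  "phase_level a b \<xi> \<theta> = (sqrt (a / b) * tan (max 0 \<theta>)) powr \<xi>"

lemma decay_phase_less: "decay_phase a b \<xi> y < pi / 2"
  unfolding decay_phase_def by (rule arctan_ubound)

lemma decay_phase_deriv:
  assumes "a > 0" "b > 0" "\<xi> > 1" "y > 0"
  shows "(decay_phase a b \<xi> has_real_derivative (sqrt (a * b) / \<xi>) / decay_rate a b \<xi> y) (at y)"
proof -
  define w where "w = y powr (1 / \<xi>)"
  have w: "w > 0" unfolding w_def using assms by simp
  have 1: "y powr (1 - 1/\<xi>) = y / w" "y powr (1 + 1/\<xi>) = y * w" "y powr (1/\<xi> - 1) = w / y"
    unfolding w_def using assms by (simp_all add: powr_diff powr_add)
  have sq: "sqrt (b / a) * a = sqrt (a * b)"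
    using assms by (simp add: real_sqrt_divide real_sqrt_mult real_div_sqrt field_simps)
  have "(decay_phase a b \<xi> has_real_derivative
      (sqrt (b / a) * (1 / \<xi> * (w / y))) / (1 + (sqrt (b / a) * w)\<^sup>2)) (at y)"
    unfolding decay_phase_def w_def
    using assms 1(3)
    by (auto intro!: derivative_eq_intros simp: w_def divide_inverse mult_ac)
  also have "(sqrt (b / a) * (1 / \<xi> * (w / y))) / (1 + (sqrt (b / a) * w)\<^sup>2)
      = (sqrt (a * b) / \<xi>) / decay_rate a b \<xi> y"
  proof -
    have "(sqrt (b / a) * w)\<^sup>2 = b / a * w\<^sup>2" using assms by (simp add: power_mult_distrib)
    moreover have "1 + b / a * w\<^sup>2 > 0" using assms w by (simp add: add_pos_nonneg)
    moreover have "a + b * w\<^sup>2 > 0" using assms w by (simp add: add_pos_nonneg)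
    moreover have "decay_rate a b \<xi> y = y / w * (a + b * w\<^sup>2)"
      unfolding decay_rate_def 1 using w by (simp add: field_simps power2_eq_square)
    ultimately have "(sqrt (b / a) * (1 / \<xi> * (w / y))) / (1 + (sqrt (b / a) * w)\<^sup>2)
        = (sqrt (b / a) * (1 / \<xi> * (w / y))) / (1 + b / a * w\<^sup>2)"
      and "(sqrt (a * b) / \<xi>) / decay_rate a b \<xi> y
        = (sqrt (b / a) * a / \<xi>) / (y / w * (a + b * w\<^sup>2))"
      by (simp_all only: sq)
    moreover have "(sqrt (b / a) * a / \<xi>) / (y / w * (a + b * w\<^sup>2))
        = (sqrt (b / a) * (1 / \<xi> * (w / y))) / ((a + b * w\<^sup>2) / a)"
      using assms w by (simp add: mult_ac)
    moreover have "(a + b * w\<^sup>2) / a = 1 + b / a * w\<^sup>2"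
      using assms by (simp add: add_divide_distrib)
    ultimately show ?thesis by presburger
  qed
  finally show ?thesis .
qed

lemma decay_rate_pos: "a > 0 \<Longrightarrow> b > 0 \<Longrightarrow> y > 0 \<Longrightarrow> decay_rate a b \<xi> y > 0"
  unfolding decay_rate_def by (simp add: add_pos_pos)

lemma decay_rate_mono:
  "a > 0 \<Longrightarrow> b > 0 \<Longrightarrow> \<xi> > 1 \<Longrightarrow> 0 \<le> y \<Longrightarrow> y \<le> z \<Longrightarrow> decay_rate a b \<xi> y \<le> decay_rate a b \<xi> z"
  unfolding decay_rate_def by (intro add_mono mult_left_mono powr_mono2) auto

lemma phase_level_decay_phase:
  assumes "a > 0" "b > 0" "\<xi> > 1" "y \<ge> 0"
  shows "phase_level a b \<xi> (decay_phase a b \<xi> y) = y"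
proof -
  have "decay_phase a b \<xi> y \<ge> 0" unfolding decay_phase_def using assms by simp
  then have "phase_level a b \<xi> (decay_phase a b \<xi> y) = (sqrt (a / b) * sqrt (b / a) * y powr (1 / \<xi>)) powr \<xi>"
    unfolding phase_level_def by (simp add: decay_phase_def tan_arctan mult.assoc)
  also have "sqrt (a / b) * sqrt (b / a) = 1"
    using assms by (simp flip: real_sqrt_mult)
  finally show ?thesis using assms by (simp add: powr_powr)
qed

lemma phase_level_mono:
  assumes "a > 0" "b > 0" "\<xi> > 1" "\<theta> \<le> \<theta>'" "\<theta>' < pi / 2"
  shows "phase_level a b \<xi> \<theta> \<le> phase_level a b \<xi> \<theta>'"
proof -
  have "tan (max 0 \<theta>) \<le> tan (max 0 \<theta>')"
    using assms by (intro tan_mono_le) (auto simp: max_def intro: less_trans[of _ 0])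
  moreover have "0 \<le> tan (max 0 \<theta>)"
    using assms tan_mono_le[of 0 "max 0 \<theta>"] by (auto simp: max_def)
  ultimately show ?thesis
    unfolding phase_level_def using assms by (intro powr_mono2 mult_left_mono) auto
qed

lemma continuous_on_phase_level:
  assumes "a > 0" "b > 0" "\<xi> > 1"
  shows "continuous_on {..<pi / 2} (phase_level a b \<xi>)"
proof -
  have "cos (max 0 \<theta>) \<noteq> 0" "0 \<le> tan (max 0 \<theta>)" if "\<theta> < pi / 2" for \<theta>
    using that cos_gt_zero_pi[of "max 0 \<theta>"] tan_mono_le[of 0 "max 0 \<theta>"]
    by (auto simp: max_def less_trans[of _ 0] split: if_splits)
  then show ?thesis
    unfolding phase_level_def using assms
    by (intro continuous_on_powr' continuous_intros) auto
qed

text \<open>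
  As long as \<open>g\<close> is positive the comparison applies; if \<open>g t > 0\<close>, the decrease forces \<open>g > 0\<close> on all of
  \<open>{0..t}\<close>.
\<close>

lemma finite_time_decay:
  assumes ab: "a > 0" "b > 0" "\<xi> > 1" and t: "t \<ge> 0"
    and g_nonneg: "\<And>s. g s \<ge> 0"
    and dec: "\<And>s s'. 0 \<le> s \<Longrightarrow> s \<le> s' \<Longrightarrow> s' \<le> t \<Longrightarrow> g s' \<le> g s - (s' - s) * decay_rate a b \<xi> (g s')"
  shows "g t \<le> phase_level a b \<xi> (decay_phase a b \<xi> (g 0) - sqrt (a * b) / \<xi> * t)"
proof (cases "g t = 0")
  case True
  then show ?thesis unfolding phase_level_def by simp
next
  case False
  have rate_nonneg: "decay_rate a b \<xi> y \<ge> 0" if "y \<ge> 0" for y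
    unfolding decay_rate_def using ab that by simp
  have "g s > 0" if "0 \<le> s" "s \<le> t" for s
  proof -
    have "(t - s) * decay_rate a b \<xi> (g t) \<ge> 0" using that rate_nonneg g_nonneg by simp
    then show ?thesis using dec[of s t] that False g_nonneg[of t] by simp
  qed
  with dec have "decay_phase a b \<xi> (g t) \<le> decay_phase a b \<xi> (g 0) - sqrt (a * b) / \<xi> * t"
    using ab t
    by (intro decrease_comparison[where c="decay_rate a b \<xi>" and g=g and \<Theta>="decay_phase a b \<xi>"]
          decay_phase_deriv decay_rate_pos decay_rate_mono) simp_all
  moreover have "decay_phase a b \<xi> (g 0) - sqrt (a * b) / \<xi> * t < pi / 2"
  proof -
    have "sqrt (a * b) / \<xi> * t \<ge> 0" using ab t by simp
    moreover have "decay_phase a b \<xi> (g 0) < pi / 2" by (rule decay_phase_less)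
    ultimately show ?thesis by linarith
  qed
  ultimately have "phase_level a b \<xi> (decay_phase a b \<xi> (g t))
      \<le> phase_level a b \<xi> (decay_phase a b \<xi> (g 0) - sqrt (a * b) / \<xi> * t)"
    by (intro phase_level_mono ab)
  then show ?thesis using phase_level_decay_phase[OF ab g_nonneg] by simp
qed

section \<open>Limits of Euler solutions\<close>

lemma euler_increment_bound:
  assumes sol: "forward_euler_solution G \<eta> x0 x" and \<eta>: "\<eta> > 0"
    and G_bound: "\<And>y v. v \<in> G y \<Longrightarrow> norm v \<le> M" and ij: "i \<le> j"
  shows "norm (x j - x i) \<le> M * (\<eta> * real (j - i))"
  using ij
proof (induction j rule: dec_induct)
  case base show ?case by simp
next
  case (step j)
  obtain v where v: "v \<in> G (x j)" "x (Suc j) = x j + \<eta> *\<^sub>R v"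
    using sol unfolding forward_euler_solution_def by blast
  have "norm (x (Suc j) - x i) \<le> norm (x j - x i) + norm (\<eta> *\<^sub>R v)"
    unfolding v(2) by (metis add_diff_eq add.commute norm_triangle_ineq)
  also have "norm (\<eta> *\<^sub>R v) \<le> \<eta> * M" using G_bound[OF v(1)] \<eta> by simp
  finally show ?case using step by (simp add: Suc_diff_le algebra_simps)
qed

text \<open>
  An average of velocities stays in every half-space that contains them. As closed convex sets are
  intersections of half-spaces, this suffices to locate limits of averages.
\<close>

lemma euler_increment_inner_ge:
  assumes sol: "forward_euler_solution G \<eta> x0 x" and \<eta>: "\<eta> > 0" and ij: "i \<le> j"
    and half_space: "\<And>k. i \<le> k \<Longrightarrow> k < j \<Longrightarrow> G (x k) \<subseteq> {v. b < w \<bullet> v}"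
  shows "b * (\<eta> * real (j - i)) \<le> w \<bullet> (x j - x i)"
  using ij half_space
proof (induction j rule: dec_induct)
  case base show ?case by simp
next
  case (step j)
  obtain v where v: "v \<in> G (x j)" "x (Suc j) = x j + \<eta> *\<^sub>R v"
    using sol unfolding forward_euler_solution_def by blast
  have "b < w \<bullet> v" using step.prems[of j] step.hyps v(1) by auto
  then have "\<eta> * b \<le> \<eta> * (w \<bullet> v)" using \<eta> by simp
  then show ?case using step unfolding v(2) by (simp add: Suc_diff_le algebra_simps)
qed

definition euler_step_function :: "real \<Rightarrow> (nat \<Rightarrow> 'a) \<Rightarrow> real \<Rightarrow> 'a" where
  "euler_step_function \<eta> x t = x (nat \<lfloor>t / \<eta>\<rfloor>)"

lemma step_index_diff:
  fixes \<eta> :: real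
  assumes "\<eta> > 0" "0 \<le> s" "s \<le> t"
  shows "nat \<lfloor>s / \<eta>\<rfloor> \<le> nat \<lfloor>t / \<eta>\<rfloor>"
    and "\<bar>\<eta> * real (nat \<lfloor>t / \<eta>\<rfloor> - nat \<lfloor>s / \<eta>\<rfloor>) - (t - s)\<bar> \<le> \<eta>"
proof -
  have st: "s / \<eta> \<le> t / \<eta>" "0 \<le> s / \<eta>" using assms by (auto intro: divide_right_mono)
  then show le: "nat \<lfloor>s / \<eta>\<rfloor> \<le> nat \<lfloor>t / \<eta>\<rfloor>" by (intro nat_mono floor_mono)
  have "real (nat \<lfloor>t / \<eta>\<rfloor> - nat \<lfloor>s / \<eta>\<rfloor>) = real_of_int \<lfloor>t / \<eta>\<rfloor> - real_of_int \<lfloor>s / \<eta>\<rfloor>"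
    using le st by (simp add: of_nat_diff)
  then have "\<bar>real (nat \<lfloor>t / \<eta>\<rfloor> - nat \<lfloor>s / \<eta>\<rfloor>) - (t / \<eta> - s / \<eta>)\<bar> \<le> 1" by linarith
  then have "\<eta> * \<bar>real (nat \<lfloor>t / \<eta>\<rfloor> - nat \<lfloor>s / \<eta>\<rfloor>) - (t / \<eta> - s / \<eta>)\<bar> \<le> \<eta> * 1"
    using assms by (intro mult_left_mono) auto
  also have "\<eta> * \<bar>real (nat \<lfloor>t / \<eta>\<rfloor> - nat \<lfloor>s / \<eta>\<rfloor>) - (t / \<eta> - s / \<eta>)\<bar>
     = \<bar>\<eta> * (real (nat \<lfloor>t / \<eta>\<rfloor> - nat \<lfloor>s / \<eta>\<rfloor>) - (t / \<eta> - s / \<eta>))\<bar>"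
    using assms by (simp add: abs_mult)
  also have "\<eta> * (real (nat \<lfloor>t / \<eta>\<rfloor> - nat \<lfloor>s / \<eta>\<rfloor>) - (t / \<eta> - s / \<eta>))
     = \<eta> * real (nat \<lfloor>t / \<eta>\<rfloor> - nat \<lfloor>s / \<eta>\<rfloor>) - (t - s)"
    using assms by (simp add: algebra_simps)
  finally show "\<bar>\<eta> * real (nat \<lfloor>t / \<eta>\<rfloor> - nat \<lfloor>s / \<eta>\<rfloor>) - (t - s)\<bar> \<le> \<eta>" by simp
qed

lemma euler_step_function_dist:
  assumes sol: "forward_euler_solution G \<eta> x0 x" and \<eta>: "\<eta> > 0"
    and G_bound: "\<And>y v. v \<in> G y \<Longrightarrow> norm v \<le> M" and M: "M \<ge> 0" and st: "0 \<le> s" "0 \<le> t"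
  shows "dist (euler_step_function \<eta> x s) (euler_step_function \<eta> x t) \<le> M * (\<bar>s - t\<bar> + \<eta>)"
proof -
  have *: "dist (euler_step_function \<eta> x s) (euler_step_function \<eta> x t) \<le> M * (\<bar>s - t\<bar> + \<eta>)"
    if "0 \<le> s" "s \<le> t" for s t
  proof -
    have "norm (x (nat \<lfloor>t / \<eta>\<rfloor>) - x (nat \<lfloor>s / \<eta>\<rfloor>)) \<le> M * (\<eta> * real (nat \<lfloor>t / \<eta>\<rfloor> - nat \<lfloor>s / \<eta>\<rfloor>))"
      using G_bound step_index_diff(1)[OF \<eta> that] by (rule euler_increment_bound[OF sol \<eta>])
    also have "\<dots> \<le> M * (\<bar>s - t\<bar> + \<eta>)"
      using step_index_diff(2)[OF \<eta> that] that M by (intro mult_left_mono) auto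
    finally show ?thesis by (simp add: euler_step_function_def dist_norm norm_minus_commute)
  qed
  show ?thesis
    using *[of s t] *[of t s] st by (cases "s \<le> t") (auto simp: dist_commute abs_minus_commute)
qed

text \<open>
  A diagonal subsequence converges at all rational times. The step functions are Lipschitz up to
  an error \<open>M * \<eta> n\<close>, so convergence extends to all times and, because this modulus is uniform, to
  convergent sequences of times. The interval is enlarged to \<open>{0..T + 1}\<close> only so that rationals
  slightly above \<open>T\<close> are available.
\<close>

lemma euler_limit_curve:
  fixes G :: "'a::euclidean_space \<Rightarrow> 'a set" and x :: "nat \<Rightarrow> nat \<Rightarrow> 'a"
  assumes G_bound: "\<And>y v. v \<in> G y \<Longrightarrow> norm v \<le> M" and M: "M \<ge> 0"
    and \<eta>: "\<And>n. \<eta> n > 0" and \<eta>0: "\<eta> \<longlonglongrightarrow> 0"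
    and sol: "\<And>n. forward_euler_solution G (\<eta> n) (x n 0) (x n)"
    and start: "\<And>n. norm (x n 0) \<le> B"
  obtains r X where "strict_mono (r :: nat \<Rightarrow> nat)" "M-lipschitz_on {0..T} X"
    "\<And>t s. t \<in> {0..T} \<Longrightarrow> (\<And>n. s n \<ge> 0) \<Longrightarrow> s \<longlonglongrightarrow> t \<Longrightarrow>
       (\<lambda>n. euler_step_function (\<eta> (r n)) (x (r n)) (s n)) \<longlonglongrightarrow> X t"
proof -
  define Y where "Y n = euler_step_function (\<eta> n) (x n)" for n
  have Yd: "dist (Y n s) (Y n t) \<le> M * (\<bar>s - t\<bar> + \<eta> n)" if "0 \<le> s" "0 \<le> t" for n s t
    unfolding Y_def using that by (intro euler_step_function_dist[OF sol \<eta> G_bound M])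
  obtain E where E: "\<And>n. \<eta> n \<le> E"
    using convergent_imp_Bseq[of \<eta>] \<eta>0 unfolding convergent_def Bseq_def
    by (metis abs_ge_self order_trans real_norm_def)
  define S where "S = \<rat> \<inter> {0..T + 1}"
  have "countable S" unfolding S_def by (simp add: countable_rat countable_Int1)
  moreover have "norm (Y n q) \<le> B + M * (T + 1 + E)" if "q \<in> S" for n q
  proof -
    have "dist (Y n 0) (Y n q) \<le> M * (\<bar>0 - q\<bar> + \<eta> n)" using that by (intro Yd) (auto simp: S_def)
    also have "\<dots> \<le> M * (T + 1 + E)"
      using that M E[of n] by (intro mult_left_mono) (auto simp: S_def)
    moreover have "Y n 0 = x n 0" by (simp add: Y_def euler_step_function_def)
    ultimately show ?thesis
      using start[of n] norm_triangle_ineq2[of "Y n q" "Y n 0"] by (simp add: dist_norm norm_minus_commute)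
  qed
  ultimately obtain r where r: "strict_mono (r :: nat \<Rightarrow> nat)"
    and conv: "\<And>q. q \<in> S \<Longrightarrow> \<exists>l. (\<lambda>n. Y (r n) q) \<longlonglongrightarrow> l"
    using function_convergent_subsequence[of S Y] by blast
  have \<eta>r: "(\<lambda>n. \<eta> (r n)) \<longlonglongrightarrow> 0"
    using LIMSEQ_subseq_LIMSEQ[OF \<eta>0 r] by (simp add: o_def)
  have "convergent (\<lambda>n. Y (r n) t)" if t: "t \<in> {0..T}" for t
    unfolding Cauchy_convergent_iff[symmetric]
  proof (rule metric_CauchyI)
    fix e :: real assume e: "e > 0"
    define \<delta> where "\<delta> = min 1 (e / (6 * (M + 1)))"
    have \<delta>: "\<delta> > 0" "\<delta> \<le> 1" and "\<delta> \<le> e / (6 * (M + 1))"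
      using e M by (auto simp: \<delta>_def)
    then have \<delta>': "6 * ((M + 1) * \<delta>) \<le> e" using M by (simp add: le_divide_eq mult_ac)
    obtain q where q: "q \<in> \<rat>" "t < q" "q < t + \<delta>" using Rats_dense_in_real[of t "t + \<delta>"] \<delta> by auto
    have qS: "q \<in> S" using q t \<delta> by (auto simp: S_def)
    have "Cauchy (\<lambda>n. Y (r n) q)" using conv[OF qS] convergent_def Cauchy_convergent_iff by blast
    then obtain N1 where N1: "\<And>m n. m \<ge> N1 \<Longrightarrow> n \<ge> N1 \<Longrightarrow> dist (Y (r m) q) (Y (r n) q) < e / 3"
      using metric_CauchyD[of _ "e/3"] e by (metis divide_pos_pos zero_less_numeral)
    obtain N2 where N2: "\<And>n. n \<ge> N2 \<Longrightarrow> \<eta> (r n) < \<delta>"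
      using order_tendstoD(2)[OF \<eta>r \<delta>(1)] unfolding eventually_sequentially by blast
    have near: "dist (Y (r n) t) (Y (r n) q) \<le> e / 3" if "n \<ge> N2" for n
    proof -
      have "dist (Y (r n) t) (Y (r n) q) \<le> M * (\<bar>t - q\<bar> + \<eta> (r n))" using q t by (intro Yd) auto
      also have "\<dots> \<le> M * (\<delta> + \<delta>)" using q N2[OF that] M by (intro mult_left_mono) auto
      also have "\<dots> \<le> e / 3" using \<delta> \<delta>' M by (simp add: algebra_simps)
      finally show ?thesis .
    qed
    show "\<exists>N. \<forall>m\<ge>N. \<forall>n\<ge>N. dist (Y (r m) t) (Y (r n) t) < e"
    proof (intro exI allI impI)
      fix m n assume "max N1 N2 \<le> m" "max N1 N2 \<le> n"
      then have "dist (Y (r m) q) (Y (r n) q) < e / 3" "dist (Y (r m) t) (Y (r m) q) \<le> e / 3"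
        "dist (Y (r n) t) (Y (r n) q) \<le> e / 3"
        using N1 near by auto
      then show "dist (Y (r m) t) (Y (r n) t) < e"
        using dist_triangle[of "Y (r m) t" "Y (r n) t" "Y (r m) q"]
          dist_triangle[of "Y (r m) q" "Y (r n) t" "Y (r n) q"] by (simp add: dist_commute)
    qed
  qed
  then obtain X where X: "\<And>t. t \<in> {0..T} \<Longrightarrow> (\<lambda>n. Y (r n) t) \<longlonglongrightarrow> X t"
    unfolding convergent_def by metis
  show thesis
  proof (rule that[of r X])
    show "strict_mono r" by (rule r)
    show "M-lipschitz_on {0..T} X"
    proof (rule lipschitz_onI)
      fix s t assume st: "s \<in> {0..T}" "t \<in> {0..T}"
      have "(\<lambda>n. dist (Y (r n) s) (Y (r n) t)) \<longlonglongrightarrow> dist (X s) (X t)"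
        by (intro tendsto_dist X st)
      moreover have "(\<lambda>n. M * (\<bar>s - t\<bar> + \<eta> (r n))) \<longlonglongrightarrow> M * (\<bar>s - t\<bar> + 0)"
        by (intro tendsto_intros \<eta>r)
      ultimately have "dist (X s) (X t) \<le> M * (\<bar>s - t\<bar> + 0)"
        by (rule LIMSEQ_le) (use Yd st in auto)
      then show "dist (X s) (X t) \<le> M * dist s t" by (simp add: dist_real_def)
    qed (rule M)
    fix t s assume t: "t \<in> {0..T}" and s0: "\<And>n. s n \<ge> 0" and s: "s \<longlonglongrightarrow> t"
    have lim0: "(\<lambda>n. M * (\<bar>s n - t\<bar> + \<eta> (r n))) \<longlonglongrightarrow> M * (\<bar>t - t\<bar> + 0)"
      by (intro tendsto_intros s \<eta>r)
    have "norm (Y (r n) (s n) - Y (r n) t) \<le> M * (\<bar>s n - t\<bar> + \<eta> (r n))" for n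
      using Yd[of "s n" t "r n"] s0 t by (simp add: dist_norm)
    then have "(\<lambda>n. Y (r n) (s n) - Y (r n) t) \<longlonglongrightarrow> 0"
      by (intro Lim_null_comparison[OF _ lim0[simplified]]) auto
    from tendsto_add[OF this X[OF t]]
    show "(\<lambda>n. euler_step_function (\<eta> (r n)) (x (r n)) (s n)) \<longlonglongrightarrow> X t"
      by (simp add: Y_def)
  qed
qed

text \<open>
  If a limit \<open>v\<close> of right difference quotients were outside the closed convex set \<open>G (X t)\<close>, a hyperplane
  would separate them. By upper semicontinuity, near \<open>X t\<close> all values of \<open>G\<close> lie on the far side of the
  hyperplane, hence so do the average velocities of the Euler solutions over short times and
  their limits, up to the hyperplane itself.
\<close>

lemma euler_limit_velocity:
  fixes G :: "'a::euclidean_space \<Rightarrow> 'a set" and x :: "nat \<Rightarrow> nat \<Rightarrow> 'a"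
  assumes usc: "upper_semicontinuous_map G" and G_values: "\<And>y. convex (G y) \<and> closed (G y)"
    and G_bound: "\<And>y v. v \<in> G y \<Longrightarrow> norm v \<le> M" and M: "M \<ge> 0"
    and \<eta>: "\<And>n. \<eta> n > 0" and \<eta>0: "\<eta> \<longlonglongrightarrow> 0"
    and sol: "\<And>n. forward_euler_solution G (\<eta> n) (x n 0) (x n)"
    and conv: "\<And>t. t \<in> {0..T} \<Longrightarrow> (\<lambda>n. euler_step_function (\<eta> n) (x n) t) \<longlonglongrightarrow> X t"
    and t: "0 \<le> t" "t < T"
    and h: "filterlim h (at_right 0) sequentially"
    and v: "(\<lambda>n. (X (t + h n) - X t) /\<^sub>R h n) \<longlonglongrightarrow> v"
  shows "v \<in> G (X t)"
proof (rule ccontr)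
  assume "v \<notin> G (X t)"
  then obtain w b where wv: "w \<bullet> v < b" and wG: "\<And>u. u \<in> G (X t) \<Longrightarrow> b < w \<bullet> u"
    using separating_hyperplane_closed_point[of "G (X t)" v] G_values by blast
  have "open {u. b < w \<bullet> u}" by (rule open_halfspace_gt)
  then have "\<forall>\<^sub>F y in nhds (X t). G y \<subseteq> {u. b < w \<bullet> u}"
    using usc wG unfolding upper_semicontinuous_map_def by blast
  then obtain \<rho> where \<rho>: "\<rho> > 0" and G\<rho>: "\<And>y. dist y (X t) < \<rho> \<Longrightarrow> G y \<subseteq> {u. b < w \<bullet> u}"
    unfolding eventually_nhds_metric by blast
  have short: "b * s \<le> w \<bullet> (X (t + s) - X t)" if s: "0 < s" "t + s \<le> T" "M * s < \<rho>" for s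
  proof -
    define i where "i n = nat \<lfloor>t / \<eta> n\<rfloor>" for n
    define j where "j n = nat \<lfloor>(t + s) / \<eta> n\<rfloor>" for n
    have ij: "i n \<le> j n" "\<bar>\<eta> n * real (j n - i n) - s\<bar> \<le> \<eta> n" for n
      using step_index_diff[OF \<eta>[of n], of t "t + s"] t s by (simp_all add: i_def j_def del: of_nat_diff)
    have xi: "(\<lambda>n. x n (i n)) \<longlonglongrightarrow> X t" and xj: "(\<lambda>n. x n (j n)) \<longlonglongrightarrow> X (t + s)"
      using conv[of t] conv[of "t + s"] t s by (simp_all add: euler_step_function_def i_def j_def)
    have "(\<lambda>n. \<eta> n * real (j n - i n) - s) \<longlonglongrightarrow> 0"
      by (rule Lim_null_comparison[OF _ \<eta>0]) (use ij in auto)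
    from tendsto_add[OF this tendsto_const[of s]]
    have len: "(\<lambda>n. \<eta> n * real (j n - i n)) \<longlonglongrightarrow> s" by simp
    have "(\<lambda>n. M * (\<eta> n * real (j n - i n)) + dist (x n (i n)) (X t)) \<longlonglongrightarrow> M * s + dist (X t) (X t)"
      by (intro tendsto_intros len xi)
    then have "\<forall>\<^sub>F n in sequentially. M * (\<eta> n * real (j n - i n)) + dist (x n (i n)) (X t) < \<rho>"
      using s(3) by (intro order_tendstoD(2)) auto
    then have "\<forall>\<^sub>F n in sequentially. b * (\<eta> n * real (j n - i n)) \<le> w \<bullet> (x n (j n) - x n (i n))"
    proof eventually_elim
      case (elim n)
      show ?case
      proof (rule euler_increment_inner_ge[OF sol \<eta> ij(1)])
        fix k assume k: "i n \<le> k" "k < j n"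
        have "dist (x n k) (x n (i n)) \<le> M * (\<eta> n * real (k - i n))"
          unfolding dist_norm using G_bound k(1) by (rule euler_increment_bound[OF sol \<eta>])
        also have "\<dots> \<le> M * (\<eta> n * real (j n - i n))"
          using M \<eta>[of n] k by (intro mult_left_mono) auto
        finally have "dist (x n k) (X t) < \<rho>"
          using elim dist_triangle[of "x n k" "X t" "x n (i n)"] by linarith
        then show "G (x n k) \<subseteq> {v. b < w \<bullet> v}" by (rule G\<rho>)
      qed
    qed
    then show ?thesis
      by (rule tendsto_le[OF sequentially_bot tendsto_inner[OF tendsto_const tendsto_diff[OF xj xi]]
            tendsto_mult[OF tendsto_const len]])
  qed
  have h0: "h \<longlonglongrightarrow> 0" and hpos: "\<forall>\<^sub>F n in sequentially. h n > 0"
    using h by (auto simp: filterlim_at elim!: eventually_mono)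
  have "\<forall>\<^sub>F n in sequentially. h n < T - t" by (rule order_tendstoD(2)[OF h0]) (use t in auto)
  moreover have "(\<lambda>n. M * h n) \<longlonglongrightarrow> M * 0" by (intro tendsto_intros h0)
  then have "\<forall>\<^sub>F n in sequentially. M * h n < \<rho>" by (rule order_tendstoD(2)) (use \<rho> in auto)
  ultimately have "\<forall>\<^sub>F n in sequentially. b \<le> w \<bullet> ((X (t + h n) - X t) /\<^sub>R h n)"
    using hpos
  proof eventually_elim
    case (elim n)
    then have "b * h n \<le> w \<bullet> (X (t + h n) - X t)" by (intro short) auto
    then have "b \<le> (w \<bullet> (X (t + h n) - X t)) / h n" using elim by (simp add: le_divide_eq)
    then show ?case by (simp add: divide_inverse mult.commute)
  qed
  moreover have "(\<lambda>n. w \<bullet> ((X (t + h n) - X t) /\<^sub>R h n)) \<longlonglongrightarrow> w \<bullet> v"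
    by (intro tendsto_intros v)
  ultimately have "b \<le> w \<bullet> v" by (intro tendsto_lowerbound) auto
  with wv show False by simp
qed

section \<open>Upper semicontinuous maps\<close>

lemma locally_lipschitz_isCont:
  assumes "locally_lipschitz f"
  shows "isCont f x"
proof -
  obtain u L where u: "u > 0" and L: "L-lipschitz_on (ball x u) f"
    using assms unfolding locally_lipschitz_def by blast
  show ?thesis
    using lipschitz_on_continuous_on[OF L] u
    by (simp add: continuous_on_eq_continuous_at)
qed

lemma upper_semicontinuous_map_compose:
  fixes p :: "'a::t2_space \<Rightarrow> 'b::topological_space"
  assumes F: "upper_semicontinuous_map F" and p: "continuous_on UNIV p"
  shows "upper_semicontinuous_map (\<lambda>x. F (p x))"
  unfolding upper_semicontinuous_map_def
proof (intro allI impI)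
  fix x and U assume "open U \<and> F (p x) \<subseteq> U"
  then have ev: "\<forall>\<^sub>F y in nhds (p x). F y \<subseteq> U"
    using F unfolding upper_semicontinuous_map_def by blast
  have "filterlim p (nhds (p x)) (nhds x)"
    using p by (metis UNIV_I continuous_on_eq_continuous_at isCont_def open_UNIV tendsto_at_iff_tendsto_nhds)
  with ev show "\<forall>\<^sub>F y in nhds x. F (p y) \<subseteq> U"
    by (rule eventually_compose_filterlim)
qed

lemma upper_semicontinuous_map_bounded_on_compact:
  fixes F :: "'a::topological_space \<Rightarrow> 'b::real_normed_vector set"
  assumes F: "upper_semicontinuous_map F" and F_bounded: "\<And>x. bounded (F x)" and S: "compact S"
  obtains M where "M \<ge> 0" "\<And>x v. x \<in> S \<Longrightarrow> v \<in> F x \<Longrightarrow> norm v \<le> M"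
proof -
  define W where "W n = interior {z. F z \<subseteq> ball 0 (real n)}" for n :: nat
  have "S \<subseteq> (\<Union>n\<in>UNIV. W n)"
  proof
    fix x assume "x \<in> S"
    obtain B where B: "\<And>v. v \<in> F x \<Longrightarrow> norm v \<le> B" using F_bounded[of x] unfolding bounded_iff by blast
    obtain n :: nat where "B < real n" using reals_Archimedean2 by blast
    then have "F x \<subseteq> ball 0 (real n)" using B by force
    then have "\<forall>\<^sub>F z in nhds x. F z \<subseteq> ball 0 (real n)"
      using F unfolding upper_semicontinuous_map_def by blast
    then have "x \<in> W n" unfolding W_def eventually_nhds interior_def by blast
    then show "x \<in> (\<Union>n\<in>UNIV. W n)" by blast
  qed
  then obtain D where D: "finite D" "S \<subseteq> (\<Union>n\<in>D. W n)"
    using compactE_image[OF S, of UNIV W] by (auto simp: W_def)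
  show thesis
  proof (rule that)
    show "0 \<le> (\<Sum>n\<in>D. real n)" by (simp add: sum_nonneg)
    fix x v assume "x \<in> S" "v \<in> F x"
    then obtain n where n: "n \<in> D" "x \<in> W n" using D by blast
    then have "x \<in> {z. F z \<subseteq> ball 0 (real n)}" unfolding W_def using interior_subset by blast
    then have "norm v \<le> real n" using \<open>v \<in> F x\<close> by force
    also have "\<dots> \<le> (\<Sum>n\<in>D. real n)" using D n by (intro member_le_sum) auto
    finally show "norm v \<le> (\<Sum>n\<in>D. real n)" .
  qed
qed

section \<open>Tracking of the decay by Euler solutions\<close>

definition decay_bound :: "real \<Rightarrow> real \<Rightarrow> real \<Rightarrow> real \<Rightarrow> real \<Rightarrow> real" where
  "decay_bound a b \<xi> c t = phase_level a b \<xi> (decay_phase a b \<xi> c - sqrt (a * b) / \<xi> * t)"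

lemma decay_bound_mono:
  assumes "a > 0" "b > 0" "\<xi> > 1" "0 \<le> c" "c \<le> c'" "0 \<le> t"
  shows "decay_bound a b \<xi> c t \<le> decay_bound a b \<xi> c' t"
proof -
  have "decay_phase a b \<xi> c \<le> decay_phase a b \<xi> c'"
    unfolding decay_phase_def using assms by (intro arctan_monotone' mult_left_mono powr_mono2) auto
  moreover have "decay_phase a b \<xi> c' - sqrt (a * b) / \<xi> * t < pi / 2"
    using decay_phase_less[of a b \<xi> c'] assms by (smt (verit) divide_nonneg_pos mult_nonneg_nonneg real_sqrt_ge_zero)
  ultimately show ?thesis
    unfolding decay_bound_def using assms by (intro phase_level_mono) auto
qed

lemma decay_bound_le:
  assumes "a > 0" "b > 0" "\<xi> > 1" "0 \<le> c" "0 \<le> t"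
  shows "decay_bound a b \<xi> c t \<le> c"
proof -
  have "decay_bound a b \<xi> c t \<le> phase_level a b \<xi> (decay_phase a b \<xi> c)"
    unfolding decay_bound_def using assms decay_phase_less by (intro phase_level_mono) auto
  then show ?thesis using assms phase_level_decay_phase by simp
qed

lemma continuous_on_decay_bound:
  assumes "a > 0" "b > 0" "\<xi> > 1"
  shows "continuous_on {0..} (decay_bound a b \<xi> c)"
  unfolding decay_bound_def
proof (rule continuous_on_compose2[OF continuous_on_phase_level[OF assms]])
  show "continuous_on {0..} (\<lambda>t. decay_phase a b \<xi> c - sqrt (a * b) / \<xi> * t)"
    by (intro continuous_intros)
  show "(\<lambda>t. decay_phase a b \<xi> c - sqrt (a * b) / \<xi> * t) ` {0..} \<subseteq> {..<pi / 2}"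
  proof (rule image_subsetI)
    fix t :: real assume "t \<in> {0..}"
    then have "sqrt (a * b) / \<xi> * t \<ge> 0" using assms by simp
    then show "decay_phase a b \<xi> c - sqrt (a * b) / \<xi> * t \<in> {..<pi / 2}"
      using decay_phase_less[of a b \<xi> c] by simp
  qed
qed

locale fixed_time_lyapunov =
  fixes F :: "'a::euclidean_space \<Rightarrow> 'a set" and V :: "'a \<Rightarrow> real" and xbar :: 'a
    and a b \<xi> \<beta> :: real
  assumes F_usc: "upper_semicontinuous_map F"
    and F_values: "\<And>x. F x \<noteq> {} \<and> convex (F x) \<and> compact (F x)"
    and V_xbar: "V xbar = 0"
    and V_lipschitz: "locally_lipschitz V"
    and V_regular: "clarke_regular V"
    and ab: "a > 0" "b > 0" "\<xi> > 1"
    and V_decrease: "\<And>x. x \<noteq> xbar \<Longrightarrow>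
      (SUP l \<in> set_valued_derivative F V x. ereal l) \<le> ereal (- decay_rate a b \<xi> (V x))"
    and beta_pos: "\<beta> > 0"
    and V_quadratic: "\<And>x. V x \<ge> \<beta> * (norm (x - xbar))\<^sup>2"
begin

lemma V_nonneg: "V x \<ge> 0"
  using V_quadratic[of x] beta_pos by (smt (verit) mult_nonneg_nonneg zero_le_power2)

lemma rate_nonneg: "decay_rate a b \<xi> (V x) \<ge> 0"
  unfolding decay_rate_def using ab V_nonneg by simp

lemma sublevel_in_ball:
  assumes "V x < c"
  shows "dist xbar x < sqrt (c / \<beta>) + 1"
proof -
  have "(norm (x - xbar))\<^sup>2 \<le> c / \<beta>"
    using V_quadratic[of x] assms beta_pos by (simp add: le_divide_eq mult.commute)
  then have "norm (x - xbar) \<le> sqrt (c / \<beta>)" by (simp add: real_le_rsqrt)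
  then show ?thesis by (simp add: dist_norm norm_minus_commute)
qed

text \<open>
  Composing \<open>F\<close> with the projection to a ball keeps upper semicontinuity and the kind of values, but
  makes the velocities globally bounded, which the compactness argument needs. Inside the ball
  nothing changes.
\<close>

definition truncation :: "real \<Rightarrow> 'a \<Rightarrow> 'a set" where
  "truncation R y = F (closest_point (cball xbar R) y)"

lemma truncation_eq: "dist xbar y \<le> R \<Longrightarrow> truncation R y = F y"
  by (simp add: truncation_def closest_point_self)

lemma truncation_usc: "R \<ge> 0 \<Longrightarrow> upper_semicontinuous_map (truncation R)"
  unfolding truncation_def
  by (rule upper_semicontinuous_map_compose[OF F_usc continuous_on_closest_point]) auto

lemma truncation_values: "truncation R y \<noteq> {} \<and> convex (truncation R y) \<and> closed (truncation R y)"
  unfolding truncation_def using F_values compact_imp_closed by blast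

lemma truncation_bounded:
  assumes "R \<ge> 0"
  obtains M where "M \<ge> 0" "\<And>y v. v \<in> truncation R y \<Longrightarrow> norm v \<le> M"
proof -
  obtain M where "M \<ge> 0" "\<And>y v. y \<in> cball xbar R \<Longrightarrow> v \<in> F y \<Longrightarrow> norm v \<le> M"
    using upper_semicontinuous_map_bounded_on_compact[OF F_usc, of "cball xbar R"] F_values compact_imp_bounded
    by (metis compact_cball)
  moreover have "closest_point (cball xbar R) y \<in> cball xbar R" for y
    using assms by (intro closest_point_in_set) auto
  ultimately show thesis using that unfolding truncation_def by blast
qed

text \<open>
  The decay of \<open>V\<close> is known only where the truncation agrees with \<open>F\<close>. A first exit from the open ball
  is impossible, since up to that time \<open>V\<close> does not increase, so that the exit point would lie in the
  sublevel set and therefore inside the ball.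
\<close>

lemma limit_curve_bound:
  assumes X_lip: "M-lipschitz_on {0..T} X"
    and velocity: "\<And>t h v. 0 \<le> t \<Longrightarrow> t < T \<Longrightarrow> filterlim h (at_right 0) sequentially \<Longrightarrow>
       (\<lambda>n. (X (t + h n) - X t) /\<^sub>R h n) \<longlonglongrightarrow> v \<Longrightarrow> v \<in> truncation R (X t)"
    and start: "V (X 0) \<le> c" and ball: "\<And>y. V y \<le> c \<Longrightarrow> dist xbar y < R"
    and t: "0 \<le> t" "t \<le> T"
  shows "V (X t) \<le> decay_bound a b \<xi> c t"
proof -
  have rate0: "decay_rate a b \<xi> 0 = 0" by (simp add: decay_rate_def)
  have decrease: "V (X s') \<le> V (X s) - m * (s' - s)"
    if inside: "\<And>s. 0 < s \<Longrightarrow> s < \<tau> \<Longrightarrow> dist xbar (X s) < R" and \<tau>: "\<tau> \<le> T"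
      and s: "0 \<le> s" "s \<le> s'" "s' \<le> \<tau>"
      and m: "\<And>r. s < r \<Longrightarrow> r < s' \<Longrightarrow> m \<le> decay_rate a b \<xi> (V (X r))" for \<tau> s s' m
  proof (rule lyapunov_decrease_along_curve[OF V_lipschitz V_regular V_nonneg V_xbar rate0 V_decrease _ _ s m])
    show "M-lipschitz_on {0..\<tau>} X" by (rule lipschitz_on_subset[OF X_lip]) (use \<tau> in auto)
    fix t h v
    assume "0 < t" "t < \<tau>" "filterlim h (at_right 0) sequentially"
      "(\<lambda>n. (X (t + h n) - X t) /\<^sub>R h n) \<longlonglongrightarrow> v"
    then have "v \<in> truncation R (X t)" using velocity[of t h v] \<tau> by simp
    then show "v \<in> F (X t)" using inside \<open>0 < t\<close> \<open>t < \<tau>\<close> truncation_eq less_imp_le by metis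
  qed
  have inside: "dist xbar (X s) < R" if "0 \<le> s" "s \<le> T" for s
  proof (rule ccontr)
    assume outside: "\<not> dist xbar (X s) < R"
    define S where "S = {s \<in> {0..T}. R \<le> dist xbar (X s)}"
    have "continuous_on {0..T} (\<lambda>s. dist xbar (X s))"
      using lipschitz_on_continuous_on[OF X_lip] by (intro continuous_intros)
    then have "closed S"
      unfolding S_def by (intro continuous_closed_preimage_constant continuous_on_closed_Collect_le) (auto intro: continuous_intros)
    moreover have "bounded S" by (rule bounded_subset[of "{0..T}"]) (auto simp: S_def)
    ultimately have "compact S" by (simp add: compact_eq_bounded_closed)
    moreover have "S \<noteq> {}" using that outside by (auto simp: S_def)
    ultimately obtain \<tau> where \<tau>: "\<tau> \<in> S" "\<And>s. s \<in> S \<Longrightarrow> \<tau> \<le> s" using compact_attains_inf by metis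
    have "V (X \<tau>) \<le> V (X 0) - 0 * (\<tau> - 0)"
    proof (rule decrease[of \<tau>])
      fix s assume "0 < s" "s < \<tau>"
      then have "s \<notin> S" using \<tau>(2)[of s] by fastforce
      then show "dist xbar (X s) < R"
        using \<tau>(1) \<open>0 < s\<close> \<open>s < \<tau>\<close> by (auto simp: S_def)
    qed (use \<tau> rate_nonneg in \<open>auto simp: S_def\<close>)
    then have "dist xbar (X \<tau>) < R" using start by (intro ball) simp
    then show False using \<tau>(1) by (simp add: S_def)
  qed
  have mono: "V (X s') \<le> V (X s)" if "0 \<le> s" "s \<le> s'" "s' \<le> T" for s s'
    using decrease[of T s s' 0] inside rate_nonneg that by simp
  have "V (X t) \<le> decay_bound a b \<xi> (V (X 0)) t"
    unfolding decay_bound_def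
  proof (rule finite_time_decay[where g="\<lambda>s. V (X s)", OF ab t(1) V_nonneg])
    fix s s' assume s: "0 \<le> s" "s \<le> s'" "s' \<le> t"
    have "V (X s') \<le> V (X s) - decay_rate a b \<xi> (V (X s')) * (s' - s)"
    proof (rule decrease[of T])
      fix r assume "s < r" "r < s'"
      then show "decay_rate a b \<xi> (V (X s')) \<le> decay_rate a b \<xi> (V (X r))"
        using s t by (intro decay_rate_mono ab V_nonneg mono) auto
    qed (use s t inside in auto)
    then show "V (X s') \<le> V (X s) - (s' - s) * decay_rate a b \<xi> (V (X s'))"
      by (simp add: mult.commute)
  qed
  also have "\<dots> \<le> decay_bound a b \<xi> c t"
    using start t V_nonneg by (intro decay_bound_mono ab)
  finally show ?thesis .
qed

text \<open>
  Otherwise there are violations for steps tending to 0, at times in \<open>{0..T}\<close>. Along a subsequence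
  the violation times converge to some \<open>t\<close> and the solutions to a limit curve that violates its own
  bound at \<open>t\<close>, by continuity of \<open>V\<close> and of the bound.
\<close>

lemma truncated_euler_tracking:
  assumes \<delta>: "\<delta> > 0" and ball: "\<And>y. V y \<le> c \<Longrightarrow> dist xbar y < R" and R: "R \<ge> 0"
  shows "\<exists>\<eta>0>0. \<forall>\<eta> x k. 0 < \<eta> \<longrightarrow> \<eta> \<le> \<eta>0 \<longrightarrow> forward_euler_solution (truncation R) \<eta> (x 0) x \<longrightarrow>
    V (x 0) \<le> c \<longrightarrow> real k * \<eta> \<le> T \<longrightarrow> V (x k) < decay_bound a b \<xi> c (real k * \<eta>) + \<delta>"
proof (rule ccontr)
  assume neg: "\<not> ?thesis"
  have "\<exists>\<eta> x k. 0 < \<eta> \<and> \<eta> \<le> 1 / real (Suc n) \<and> forward_euler_solution (truncation R) \<eta> (x 0) x \<and>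
    V (x 0) \<le> c \<and> real k * \<eta> \<le> T \<and> decay_bound a b \<xi> c (real k * \<eta>) + \<delta> \<le> V (x k)" for n
  proof -
    have "1 / real (Suc n) > 0" by simp
    with neg show ?thesis by (metis not_less)
  qed
  then obtain \<eta>' x' k' where bad: "\<And>n. 0 < \<eta>' n" "\<And>n. \<eta>' n \<le> 1 / real (Suc n)"
    "\<And>n. forward_euler_solution (truncation R) (\<eta>' n) (x' n 0) (x' n)" "\<And>n. V (x' n 0) \<le> c"
    "\<And>n. real (k' n) * \<eta>' n \<le> T" "\<And>n. decay_bound a b \<xi> c (real (k' n) * \<eta>' n) + \<delta> \<le> V (x' n (k' n))"
    by metis
  have "seq_compact {0..T}" by (simp add: compact_imp_seq_compact)
  then obtain t s where t: "t \<in> {0..T}" and s: "strict_mono (s :: nat \<Rightarrow> nat)"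
    and ts: "((\<lambda>n. real (k' n) * \<eta>' n) \<circ> s) \<longlonglongrightarrow> t"
    using bad(1,5) unfolding seq_compact_def
    by (metis (no_types, lifting) atLeastAtMost_iff less_imp_le mult_nonneg_nonneg of_nat_0_le_iff)
  have "\<eta>' \<longlonglongrightarrow> 0"
    by (rule Lim_null_comparison[OF _ LIMSEQ_Suc[OF lim_1_over_n]])
       (use bad(1,2) in \<open>auto simp: less_imp_le\<close>)
  define \<eta> where "\<eta> n = \<eta>' (s n)" for n
  define x where "x n = x' (s n)" for n
  define k where "k n = k' (s n)" for n
  have \<eta>: "\<And>n. \<eta> n > 0" unfolding \<eta>_def using bad by simp
  have \<eta>0: "\<eta> \<longlonglongrightarrow> 0"
    using LIMSEQ_subseq_LIMSEQ[OF \<open>\<eta>' \<longlonglongrightarrow> 0\<close> s] by (simp add: \<eta>_def[abs_def] o_def)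
  have sol: "\<And>n. forward_euler_solution (truncation R) (\<eta> n) (x n 0) (x n)"
    unfolding \<eta>_def x_def using bad by simp
  have tlim: "(\<lambda>n. real (k n) * \<eta> n) \<longlonglongrightarrow> t" using ts by (simp add: k_def \<eta>_def o_def)
  obtain M where M: "M \<ge> 0" and G_bound: "\<And>y v. v \<in> truncation R y \<Longrightarrow> norm v \<le> M"
    using truncation_bounded[OF R] by blast
  have x_start: "V (x n 0) \<le> c" for n unfolding x_def using bad by simp
  have x_start_norm: "norm (x n 0) \<le> norm xbar + R" for n
    using ball[OF x_start[of n]] norm_triangle_ineq2[of "x n 0" xbar] by (simp add: dist_norm norm_minus_commute)
  obtain r X where r: "strict_mono (r :: nat \<Rightarrow> nat)" and X_lip: "M-lipschitz_on {0..T} X"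
    and conv: "\<And>t s. t \<in> {0..T} \<Longrightarrow> (\<And>n. s n \<ge> 0) \<Longrightarrow> s \<longlonglongrightarrow> t \<Longrightarrow>
       (\<lambda>n. euler_step_function (\<eta> (r n)) (x (r n)) (s n)) \<longlonglongrightarrow> X t"
    using G_bound M \<eta> \<eta>0 sol x_start_norm by (rule euler_limit_curve[where T=T])
      (assumption, rule that, assumption, assumption, blast)
  have V_lim: "(\<lambda>n. V (y n)) \<longlonglongrightarrow> V z" if "y \<longlonglongrightarrow> z" for y z
    using locally_lipschitz_isCont[OF V_lipschitz] that by (rule isCont_tendsto_compose)
  have "(\<lambda>n. x (r n) 0) \<longlonglongrightarrow> X 0"
    using conv[of 0 "\<lambda>_. 0"] t by (simp add: euler_step_function_def)
  then have start: "V (X 0) \<le> c"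
    by (intro LIMSEQ_le_const2[OF V_lim]) (use x_start in auto)
  have tr: "(\<lambda>n. real (k (r n)) * \<eta> (r n)) \<longlonglongrightarrow> t"
    using LIMSEQ_subseq_LIMSEQ[OF tlim r] by (simp add: o_def)
  have "(\<lambda>n. x (r n) (k (r n))) \<longlonglongrightarrow> X t"
    using conv[OF t _ tr] \<eta> by (simp add: euler_step_function_def less_imp_le less_imp_neq[symmetric])
  note end_lim = V_lim[OF this]
  have "V (X t) \<le> decay_bound a b \<xi> c t"
  proof (rule limit_curve_bound[OF X_lip _ start ball])
    fix t h v assume tt: "0 \<le> t" "t < T" and h: "filterlim h (at_right 0) sequentially"
      and v: "(\<lambda>n. (X (t + h n) - X t) /\<^sub>R h n) \<longlonglongrightarrow> v"
    show "v \<in> truncation R (X t)"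
    proof (rule euler_limit_velocity[where \<eta>="\<lambda>n. \<eta> (r n)" and x="\<lambda>n. x (r n)", OF truncation_usc[OF R] _ G_bound M _ _ _ _ tt h v])
      show "(\<lambda>n. \<eta> (r n)) \<longlonglongrightarrow> 0" using LIMSEQ_subseq_LIMSEQ[OF \<eta>0 r] by (simp add: o_def)
      fix t assume "t \<in> {0..T}"
      then show "(\<lambda>n. euler_step_function (\<eta> (r n)) (x (r n)) t) \<longlonglongrightarrow> X t"
        using conv[of t "\<lambda>_. t"] by auto
    qed (use truncation_values \<eta> sol in auto)
  qed (use t in auto)
  moreover have "decay_bound a b \<xi> c t + \<delta> \<le> V (X t)"
  proof (rule LIMSEQ_le[OF _ end_lim])
    have "(\<lambda>n. decay_bound a b \<xi> c (real (k (r n)) * \<eta> (r n))) \<longlonglongrightarrow> decay_bound a b \<xi> c t"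
      by (rule continuous_on_tendsto_compose[OF continuous_on_decay_bound[OF ab] tr])
         (use t \<eta> in \<open>auto simp: less_imp_le\<close>)
    then show "(\<lambda>n. decay_bound a b \<xi> c (real (k (r n)) * \<eta> (r n)) + \<delta>) \<longlonglongrightarrow> decay_bound a b \<xi> c t + \<delta>"
      by (intro tendsto_intros)
    show "\<exists>N. \<forall>n\<ge>N. decay_bound a b \<xi> c (real (k (r n)) * \<eta> (r n)) + \<delta> \<le> V (x (r n) (k (r n)))"
      unfolding k_def x_def \<eta>_def using bad(6) by blast
  qed
  ultimately show False using \<delta> by simp
qed

text \<open>
  The radius is chosen so that the ball contains the sublevel set of height \<open>c + \<delta>\<close>. A solution for \<open>F\<close>
  coincides with one for the truncation as long as it stays in the ball, and the tracking
  estimate for the latter guarantees that it does.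
\<close>

lemma euler_tracking:
  assumes \<delta>: "\<delta> > 0" and c: "c \<ge> 0"
  shows "\<exists>\<eta>0>0. \<forall>\<eta> x k. 0 < \<eta> \<longrightarrow> \<eta> \<le> \<eta>0 \<longrightarrow> forward_euler_solution F \<eta> (x 0) x \<longrightarrow>
    V (x 0) \<le> c \<longrightarrow> real k * \<eta> \<le> T \<longrightarrow> V (x k) < decay_bound a b \<xi> c (real k * \<eta>) + \<delta>"
proof -
  define R where "R = sqrt ((c + \<delta>) / \<beta>) + 1"
  have R: "R \<ge> 0" using \<delta> c beta_pos by (simp add: R_def)
  have ball: "dist xbar y < R" if "V y < c + \<delta>" for y
    using sublevel_in_ball[OF that] by (simp add: R_def)
  have ball_c: "dist xbar y < R" if "V y \<le> c" for y
    using ball that \<delta> by simp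
  obtain \<eta>0 where \<eta>0: "\<eta>0 > 0" and track: "\<forall>\<eta> x k. 0 < \<eta> \<longrightarrow> \<eta> \<le> \<eta>0 \<longrightarrow>
      forward_euler_solution (truncation R) \<eta> (x 0) x \<longrightarrow> V (x 0) \<le> c \<longrightarrow>
      real k * \<eta> \<le> T \<longrightarrow> V (x k) < decay_bound a b \<xi> c (real k * \<eta>) + \<delta>"
    using truncated_euler_tracking[where c=c and T=T, OF \<delta> ball_c R] by blast
  show ?thesis
  proof (intro exI[of _ \<eta>0] conjI \<eta>0 allI impI)
    fix \<eta> x k
    assume \<eta>: "0 < \<eta>" "\<eta> \<le> \<eta>0" and sol: "forward_euler_solution F \<eta> (x 0) x"
      and start: "V (x 0) \<le> c" and kT: "real k * \<eta> \<le> T"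
    \<comment> \<open>Follow \<open>x\<close> while it stays in the ball, and continue with an arbitrary solution for the
        truncation afterwards.\<close>
    define next_point where "next_point i z =
      (if z = x i \<and> dist xbar z \<le> R then x (Suc i)
       else z + \<eta> *\<^sub>R (SOME v. v \<in> truncation R z))" for i z
    define y where "y = rec_nat (x 0) next_point"
    have y0: "y 0 = x 0" by (simp add: y_def)
    have ySuc: "y (Suc i) = next_point i (y i)" for i by (simp add: y_def)
    have "\<exists>v \<in> truncation R (y k). y (Suc k) = y k + \<eta> *\<^sub>R v" for k
    proof (cases "y k = x k \<and> dist xbar (y k) \<le> R")
      case True
      obtain v where "v \<in> F (x k)" "x (Suc k) = x k + \<eta> *\<^sub>R v"
        using sol unfolding forward_euler_solution_def by blast
      then show ?thesis using True truncation_eq ySuc[of k] by (auto simp: next_point_def)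
    next
      case False
      have "(SOME v. v \<in> truncation R (y k)) \<in> truncation R (y k)"
        using truncation_values by (simp add: some_in_eq)
      then show ?thesis using False ySuc[of k] by (auto simp: next_point_def)
    qed
    then have y_sol: "forward_euler_solution (truncation R) \<eta> (y 0) y"
      unfolding forward_euler_solution_def by blast
    have y_bound: "V (y i) < decay_bound a b \<xi> c (real i * \<eta>) + \<delta>" if "real i * \<eta> \<le> T" for i
      using track[rule_format, of \<eta> y i] \<eta> y_sol start that by (simp add: y0)
    have "y i = x i" if "i \<le> k" for i
      using that
    proof (induction i)
      case 0 show ?case by (rule y0)
    next
      case (Suc i)
      have "real i * \<eta> \<le> real k * \<eta>" using Suc.prems \<eta> by (intro mult_right_mono) auto
      then have "V (y i) < decay_bound a b \<xi> c (real i * \<eta>) + \<delta>" using kT by (intro y_bound) simp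
      also have "\<dots> \<le> c + \<delta>" using \<eta> c by (simp add: decay_bound_le ab)
      finally have "dist xbar (y i) \<le> R" using ball by (simp add: less_imp_le)
      then show ?case using Suc ySuc[of i] by (simp add: next_point_def)
    qed
    then show "V (x k) < decay_bound a b \<xi> c (real k * \<eta>) + \<delta>"
      using y_bound[OF kT] by simp
  qed
qed

definition settling_time :: real where
  "settling_time = \<xi> * pi / (2 * sqrt (a * b))"

lemma settling_time_pos: "settling_time > 0"
  unfolding settling_time_def using ab by simp

lemma phase_settling_time: "sqrt (a * b) / \<xi> * settling_time = pi / 2"
  unfolding settling_time_def using ab by simp

lemma decay_bound_settled:
  assumes "t \<ge> settling_time"
  shows "decay_bound a b \<xi> c t = 0"
proof -
  have "sqrt (a * b) / \<xi> * t \<ge> pi / 2"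
    unfolding phase_settling_time[symmetric] using assms ab by (intro mult_left_mono) auto
  then have "max 0 (decay_phase a b \<xi> c - sqrt (a * b) / \<xi> * t) = 0"
    using decay_phase_less[of a b \<xi> c] by simp
  then show ?thesis unfolding decay_bound_def phase_level_def by simp
qed

lemma decay_bound_le_tan:
  assumes "0 < t" "t < settling_time"
  shows "decay_bound a b \<xi> c t \<le> (sqrt (a / b) * tan (pi / 2 - sqrt (a * b) / \<xi> * t)) powr \<xi>"
proof -
  have \<kappa>: "sqrt (a * b) / \<xi> > 0" using ab by simp
  have "sqrt (a * b) / \<xi> * t > 0" using \<kappa> assms(1) by (rule mult_pos_pos)
  moreover have "sqrt (a * b) / \<xi> * t < pi / 2"
    unfolding phase_settling_time[symmetric] using \<kappa> assms by (intro mult_strict_left_mono)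
  ultimately have "decay_bound a b \<xi> c t \<le> phase_level a b \<xi> (pi / 2 - sqrt (a * b) / \<xi> * t)"
    unfolding decay_bound_def using decay_phase_less[of a b \<xi> c] by (intro phase_level_mono ab) linarith+
  then show ?thesis
    using \<open>sqrt (a * b) / \<xi> * t < pi / 2\<close> by (simp add: phase_level_def)
qed

lemma forward_euler_solution_shift:
  assumes "forward_euler_solution F \<eta> (x 0) x"
  shows "forward_euler_solution F \<eta> (x (m + 0)) (\<lambda>k. x (m + k))"
  using assms unfolding forward_euler_solution_def by auto

text \<open>
  The number \<open>N\<close> of steps satisfies \<open>settling_time \<le> N * \<eta> \<le> 2 * settling_time\<close>. After \<open>N\<close> steps \<open>V\<close> is
  below \<open>\<delta>/2\<close>; from then on, blocks of \<open>N\<close> steps start and end in the sublevel set of height \<open>\<delta>/2\<close>,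
  and within a block \<open>V\<close> exceeds this height by less than \<open>\<delta>/2\<close>.
\<close>

lemma euler_practical_fixed_time_stability:
  assumes \<delta>: "\<delta> > 0" and c: "c \<ge> 0"
  shows "\<exists>\<eta>0>0. \<forall>\<eta> x k. 0 < \<eta> \<longrightarrow> \<eta> \<le> \<eta>0 \<longrightarrow> forward_euler_solution F \<eta> (x 0) x \<longrightarrow>
    V (x 0) \<le> c \<longrightarrow> V (x k) < decay_bound a b \<xi> c (real k * \<eta>) + \<delta>"
proof -
  have \<delta>2: "\<delta> / 2 > 0" using \<delta> by simp
  let ?S = settling_time
  obtain \<eta>1 where \<eta>1: "\<eta>1 > 0" and track1: "\<forall>\<eta> x k. 0 < \<eta> \<longrightarrow> \<eta> \<le> \<eta>1 \<longrightarrow>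
      forward_euler_solution F \<eta> (x 0) x \<longrightarrow> V (x 0) \<le> c \<longrightarrow>
      real k * \<eta> \<le> 2 * ?S \<longrightarrow> V (x k) < decay_bound a b \<xi> c (real k * \<eta>) + \<delta> / 2"
    using euler_tracking[OF \<delta>2 c, of "2 * ?S"] by blast
  obtain \<eta>2 where \<eta>2: "\<eta>2 > 0" and track2: "\<forall>\<eta> x k. 0 < \<eta> \<longrightarrow> \<eta> \<le> \<eta>2 \<longrightarrow>
      forward_euler_solution F \<eta> (x 0) x \<longrightarrow> V (x 0) \<le> \<delta> / 2 \<longrightarrow>
      real k * \<eta> \<le> 2 * ?S \<longrightarrow> V (x k) < decay_bound a b \<xi> (\<delta> / 2) (real k * \<eta>) + \<delta> / 2"
    using euler_tracking[OF \<delta>2 less_imp_le[OF \<delta>2], of "2 * ?S"] by blast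
  let ?\<eta>0 = "min (min \<eta>1 \<eta>2) ?S"
  have \<eta>0: "?\<eta>0 > 0" using \<eta>1 \<eta>2 settling_time_pos by simp
  show ?thesis
  proof (intro exI[of _ ?\<eta>0] conjI \<eta>0 allI impI)
    fix \<eta> x k
    assume \<eta>: "0 < \<eta>" "\<eta> \<le> min (min \<eta>1 \<eta>2) ?S"
      and sol: "forward_euler_solution F \<eta> (x 0) x" and start: "V (x 0) \<le> c"
    define N where "N = nat \<lceil>?S / \<eta>\<rceil>"
    have "real N < ?S / \<eta> + 1" "?S / \<eta> \<le> real N"
      unfolding N_def using divide_pos_pos[OF settling_time_pos \<eta>(1)] by linarith+
    then have N: "?S \<le> real N * \<eta>" "real N * \<eta> \<le> 2 * ?S"
      using \<eta> by (simp_all add: field_simps)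
    then have N_pos: "N > 0" using settling_time_pos by (cases N) auto
    have shifted: "V (x (m + j)) < decay_bound a b \<xi> (\<delta> / 2) (real j * \<eta>) + \<delta> / 2"
      if "V (x m) \<le> \<delta> / 2" "j \<le> N" for m j
    proof -
      have "real j * \<eta> \<le> real N * \<eta>" using that \<eta> by (intro mult_right_mono) auto
      then have "real j * \<eta> \<le> 2 * ?S" using N by linarith
      then show ?thesis
        using track2[rule_format, OF _ _ forward_euler_solution_shift[OF sol, of m], of j] \<eta> that N by simp
    qed
    have multiples: "V (x (Suc i * N)) \<le> \<delta> / 2" for i
    proof (induction i)
      case 0
      have "V (x N) < decay_bound a b \<xi> c (real N * \<eta>) + \<delta> / 2"
        using \<eta> sol start N by (intro track1[rule_format]) auto
      then show ?case using decay_bound_settled[OF N(1)] by simp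
    next
      case (Suc i)
      have "V (x (Suc i * N + N)) < decay_bound a b \<xi> (\<delta> / 2) (real N * \<eta>) + \<delta> / 2"
        using Suc by (intro shifted) auto
      then show ?case using decay_bound_settled[OF N(1)] by (simp add: add.commute)
    qed
    show "V (x k) < decay_bound a b \<xi> c (real k * \<eta>) + \<delta>"
    proof (cases "k < N")
      case True
      then have "real k * \<eta> \<le> real N * \<eta>" using \<eta> by (intro mult_right_mono) auto
      with N(2) have "real k * \<eta> \<le> 2 * ?S" by linarith
      then have "V (x k) < decay_bound a b \<xi> c (real k * \<eta>) + \<delta> / 2"
        using \<eta> sol start N by (intro track1[rule_format]) auto
      then show ?thesis using \<delta> by simp
    next
      case False
      then obtain i where i: "k div N = Suc i" using N_pos by (metis div_greater_zero_iff gr0_implies_Suc not_less)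
      have "k = Suc i * N + k mod N" using i by (metis div_mult_mod_eq)
      moreover have "V (x (Suc i * N + k mod N)) < decay_bound a b \<xi> (\<delta> / 2) (real (k mod N) * \<eta>) + \<delta> / 2"
        using N_pos by (intro shifted multiples) (simp add: less_imp_le)
      moreover have "decay_bound a b \<xi> (\<delta> / 2) (real (k mod N) * \<eta>) \<le> \<delta> / 2"
        using \<delta> \<eta> by (intro decay_bound_le ab) auto
      moreover have "decay_bound a b \<xi> c (real k * \<eta>) \<ge> 0" by (simp add: decay_bound_def phase_level_def)
      ultimately show ?thesis by simp
    qed
  qed
qed

lemma norm_less_of_V_less:
  assumes "V x < p\<^sup>2 + \<beta> * \<epsilon>\<^sup>2" "p \<ge> 0" "\<epsilon> > 0"
  shows "norm (x - xbar) < 1 / sqrt \<beta> * p + \<epsilon>"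
proof (rule power2_less_imp_less)
  have "\<beta> * (norm (x - xbar))\<^sup>2 < p\<^sup>2 + \<beta> * \<epsilon>\<^sup>2"
    using V_quadratic[of x] assms by simp
  then have "(norm (x - xbar))\<^sup>2 < p\<^sup>2 / \<beta> + \<epsilon>\<^sup>2"
    using beta_pos by (simp add: field_simps)
  also have "p\<^sup>2 / \<beta> = (1 / sqrt \<beta> * p)\<^sup>2"
    using beta_pos by (simp add: power_mult_distrib power_divide)
  also have "(1 / sqrt \<beta> * p)\<^sup>2 + \<epsilon>\<^sup>2 \<le> (1 / sqrt \<beta> * p + \<epsilon>)\<^sup>2"
    using assms beta_pos by (simp add: power2_sum)
  finally show "(norm (x - xbar))\<^sup>2 < (1 / sqrt \<beta> * p + \<epsilon>)\<^sup>2" .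
  show "0 \<le> 1 / sqrt \<beta> * p + \<epsilon>" using assms beta_pos by simp
qed

end

section \<open>Practical fixed-time stability of the Euler scheme\<close>

theorem theorem4:
  fixes F :: "'a::euclidean_space \<Rightarrow> 'a set"
    and V :: "'a \<Rightarrow> real"
    and xbar :: 'a
    and a b \<xi> \<beta> :: real
  assumes F_usc: "upper_semicontinuous_map F"
    and F_values: "\<And>x. F x \<noteq> {} \<and> convex (F x) \<and> compact (F x)"
    and F_xbar: "0 \<in> F xbar"
    and V_xbar: "V xbar = 0"
    and V_pos: "\<And>x. x \<noteq> xbar \<Longrightarrow> V x > 0"
    and V_unbounded: "filterlim V at_top at_infinity"
    and V_lipschitz: "locally_lipschitz V"
    and V_regular: "clarke_regular V"
    and a_pos: "a > 0" and b_pos: "b > 0" and xi_gt: "\<xi> > 1"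
    and V_decrease: "\<And>x. x \<noteq> xbar \<Longrightarrow>
      (SUP l \<in> set_valued_derivative F V x. ereal l)
        \<le> ereal (- (a * V x powr (1 - 1 / \<xi>) + b * V x powr (1 + 1 / \<xi>)))"
    and beta_pos: "\<beta> > 0"
    and V_quadratic: "\<And>x. V x \<ge> \<beta> * (norm (x - xbar))\<^sup>2"
  shows "\<forall>x0. \<forall>\<epsilon>>0. \<exists>\<eta>star>0. \<forall>\<eta>. 0 < \<eta> \<and> \<eta> \<le> \<eta>star \<longrightarrow>
    (\<forall>x. forward_euler_solution F \<eta> x0 x \<longrightarrow>
      (\<forall>k. ereal (norm (x k - xbar)) < euler_bound a b \<xi> \<beta> \<epsilon> \<eta> k))"
proof (intro allI impI)
  fix x0 :: 'a and \<epsilon> :: real assume \<epsilon>: "\<epsilon> > 0"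
  interpret fixed_time_lyapunov F V xbar a b \<xi> \<beta>
    using F_usc F_values V_xbar V_lipschitz V_regular a_pos b_pos xi_gt V_decrease beta_pos V_quadratic
    by unfold_locales (auto simp: decay_rate_def)
  have "\<beta> * \<epsilon>\<^sup>2 > 0" using beta_pos \<epsilon> by simp
  then obtain \<eta>0 where \<eta>0: "\<eta>0 > 0" and bound: "\<forall>\<eta> x k. 0 < \<eta> \<longrightarrow> \<eta> \<le> \<eta>0 \<longrightarrow>
      forward_euler_solution F \<eta> (x 0) x \<longrightarrow> V (x 0) \<le> V x0 \<longrightarrow>
      V (x k) < decay_bound a b \<xi> (V x0) (real k * \<eta>) + \<beta> * \<epsilon>\<^sup>2"
    using euler_practical_fixed_time_stability[of "\<beta> * \<epsilon>\<^sup>2" "V x0"] V_nonneg by blast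
  show "\<exists>\<eta>star>0. \<forall>\<eta>. 0 < \<eta> \<and> \<eta> \<le> \<eta>star \<longrightarrow>
    (\<forall>x. forward_euler_solution F \<eta> x0 x \<longrightarrow>
      (\<forall>k. ereal (norm (x k - xbar)) < euler_bound a b \<xi> \<beta> \<epsilon> \<eta> k))"
  proof (intro exI[of _ \<eta>0] conjI \<eta>0 allI impI)
    fix \<eta> x k assume \<eta>: "0 < \<eta> \<and> \<eta> \<le> \<eta>0" and sol: "forward_euler_solution F \<eta> x0 x"
    have "x 0 = x0" using sol by (simp add: forward_euler_solution_def)
    then have Vk: "V (x k) < decay_bound a b \<xi> (V x0) (real k * \<eta>) + \<beta> * \<epsilon>\<^sup>2"
      using bound[rule_format, of \<eta> x k] \<eta> sol by simp
    have threshold: "real k < \<xi> * pi / (2 * \<eta> * sqrt (a * b)) \<longleftrightarrow> real k * \<eta> < settling_time"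
      unfolding settling_time_def using \<eta> a_pos b_pos by (simp add: field_simps)
    consider "k = 0" | "k > 0" "real k * \<eta> < settling_time" | "k > 0" "real k * \<eta> \<ge> settling_time"
      by linarith
    then show "ereal (norm (x k - xbar)) < euler_bound a b \<xi> \<beta> \<epsilon> \<eta> k"
    proof cases
      case 1
      then show ?thesis by (simp add: euler_bound_def)
    next
      case 2
      define p where "p = (sqrt (a / b) * tan (pi / 2 - sqrt (a * b) / \<xi> * \<eta> * real k)) powr (\<xi> / 2)"
      have "p\<^sup>2 = (sqrt (a / b) * tan (pi / 2 - sqrt (a * b) / \<xi> * (real k * \<eta>))) powr \<xi>"
        unfolding p_def power2_eq_square by (simp add: mult_ac flip: powr_add)
      then have "V (x k) < p\<^sup>2 + \<beta> * \<epsilon>\<^sup>2"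
        using Vk decay_bound_le_tan[of "real k * \<eta>" "V x0"] 2 \<eta> by simp
      then have "norm (x k - xbar) < 1 / sqrt \<beta> * p + \<epsilon>"
        by (rule norm_less_of_V_less) (auto simp: p_def \<epsilon>)
      then show ?thesis using 2 threshold by (simp add: euler_bound_def p_def)
    next
      case 3
      then have "V (x k) < 0\<^sup>2 + \<beta> * \<epsilon>\<^sup>2" using Vk decay_bound_settled by simp
      from norm_less_of_V_less[OF this] have "norm (x k - xbar) < \<epsilon>" using \<epsilon> by simp
      then show ?thesis using 3 threshold by (simp add: euler_bound_def)
    qed
  qed
qed

end
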